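(* Let $\Omega\subset\mathbb{R}^n$ be a bounded domain with $C^2$ boundary, $j\in\mathbb{Z}_{\ge0}$, $0<\alpha<1$. Let $U$ be an $n_U$-dimensional linear subspace of $\mathbb{R}^{n\times n}_{sym}$ having a basis $\xi_1\otimes\xi_1,\dots,\xi_{n_U}\otimes\xi_{n_U}$ consisting of matrices of unit matrix norm, and let $\hat M>0$. Then there exist $M_1,M_2>0$ such that for every $\hat D\in C^{j,\alpha}(\overline{\Omega},U)$ with $\|\hat D\|_\alpha\le\hat M$ there are $\hat\Phi\in C^\infty(\overline\Omega,\mathbb{R}^n)$ and $a_i\in C^{j,\alpha}(\overline\Omega,\mathbb{R})$, $1\le i\le n_U$, with $$\hat D+\mathrm{Sym}\nabla\hat\Phi=\sum_{i=1}^{n_U}a_i^2\,\xi_i\otimes\xi_i,$$ $\nabla\hat\Phi$ constant on $\Omega$, and $$\Big\|\sum_{i=1}^{n_U}a_i^2\xi_i\otimes\xi_i\Big\|_\alpha+|\nabla\hat\Phi|+\|\hat\Phi\|_\alpha\le M_1\|\hat D\|_\alpha,\qquad \Big[\sum_{i=1}^{n_U}a_i^2\xi_i\otimes\xi_i\Big]_{j,\alpha}+|\nabla\hat\Phi|+\|\hat\Phi\|_\alpha\le M_2\|\hat D\|_{j+\alpha}.$$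
   Context: $\mathrm{Sym}(B)=\frac12(B+B^T)$; $\xi\otimes\xi=\xi\xi^T$; $\|\cdot\|_\alpha$ is the $C^{0,\alpha}(\overline\Omega)$ norm, $\|\cdot\|_{j+\alpha}$ the $C^{j,\alpha}$ norm, $[\cdot]_{j,\alpha}$ the $\alpha$-Hölder seminorm of $j$-th derivatives, and $|\nabla\hat\Phi|$ the norm of the constant matrix $\nabla\hat\Phi$. *)

theory Defs
  imports "HOL-Analysis.Analysis"
begin

text \<open>Partial derivative in coordinate direction i (defined pointwise; only meaningful
  where it exists).\<close>
definition pdir :: "'n::finite \<Rightarrow> (real^'n \<Rightarrow> 'b::real_normed_vector) \<Rightarrow> real^'n \<Rightarrow> 'b" where
  "pdir i f x = vector_derivative (\<lambda>t. f (x + t *\<^sub>R axis i 1)) (at 0)"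

text \<open>Iterated partial derivative along a multi-index given as a list of directions.\<close>
fun pdiff :: "'n::finite list \<Rightarrow> (real^'n \<Rightarrow> 'b::real_normed_vector) \<Rightarrow> real^'n \<Rightarrow> 'b" where
  "pdiff [] f = f"
| "pdiff (i # is) f = pdir i (pdiff is f)"

text \<open>All partial derivatives of order \<le> k exist at every point of the open set S.\<close>
definition has_pderivs_upto :: "(real^'n::finite) set \<Rightarrow> nat \<Rightarrow> (real^'n \<Rightarrow> 'b::real_normed_vector) \<Rightarrow> bool" where
  "has_pderivs_upto S k f \<longleftrightarrow>
     (\<forall>\<beta> i x. length \<beta> < k \<longrightarrow> x \<in> S \<longrightarrow>
        ((\<lambda>t. pdiff \<beta> f (x + t *\<^sub>R axis i 1)) has_vector_derivative pdiff (i # \<beta>) f x) (at 0))"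

text \<open>C^k on an open set S (classical: all partials up to order k exist and are continuous).\<close>
definition Ck_on :: "nat \<Rightarrow> (real^'n::finite) set \<Rightarrow> (real^'n \<Rightarrow> 'b::real_normed_vector) \<Rightarrow> bool" where
  "Ck_on k S f \<longleftrightarrow> has_pderivs_upto S k f \<and> (\<forall>\<beta>. length \<beta> \<le> k \<longrightarrow> continuous_on S (pdiff \<beta> f))"

text \<open>C^k(closure Omega): C^k in Omega, with f continuous on the closure and all derivatives
  up to order k uniformly continuous on (bounded) Omega, i.e. continuously extendable to the closure.\<close>
definition Ck_closure :: "nat \<Rightarrow> (real^'n::finite) set \<Rightarrow> (real^'n \<Rightarrow> 'b::real_normed_vector) \<Rightarrow> bool" where
  "Ck_closure k \<Omega> f \<longleftrightarrow> continuous_on (closure \<Omega>) f \<and> has_pderivs_upto \<Omega> k f \<and>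
     (\<forall>\<beta>. length \<beta> \<le> k \<longrightarrow> uniformly_continuous_on \<Omega> (pdiff \<beta> f))"

definition Cinf_closure :: "(real^'n::finite) set \<Rightarrow> (real^'n \<Rightarrow> 'b::real_normed_vector) \<Rightarrow> bool" where
  "Cinf_closure \<Omega> f \<longleftrightarrow> (\<forall>k. Ck_closure k \<Omega> f)"

text \<open>The set of alpha-Hoelder difference quotients of g on Omega.\<close>
definition holder_quots :: "(real^'n::finite) set \<Rightarrow> real \<Rightarrow> (real^'n \<Rightarrow> 'b::real_normed_vector) \<Rightarrow> real set" where
  "holder_quots \<Omega> \<alpha> g = {norm (g x - g y) / (dist x y) powr \<alpha> | x y. x \<in> \<Omega> \<and> y \<in> \<Omega> \<and> x \<noteq> y}"

definition holder_semi :: "(real^'n::finite) set \<Rightarrow> real \<Rightarrow> (real^'n \<Rightarrow> 'b::real_normed_vector) \<Rightarrow> real" where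
  "holder_semi \<Omega> \<alpha> g = Sup (holder_quots \<Omega> \<alpha> g)"

text \<open>Hoelder space C^{k,alpha}(closure Omega).\<close>
definition holder_space :: "(real^'n::finite) set \<Rightarrow> nat \<Rightarrow> real \<Rightarrow> (real^'n \<Rightarrow> 'b::real_normed_vector) \<Rightarrow> bool" where
  "holder_space \<Omega> k \<alpha> f \<longleftrightarrow> Ck_closure k \<Omega> f \<and>
     (\<forall>\<beta>. length \<beta> = k \<longrightarrow> bdd_above (holder_quots \<Omega> \<alpha> (pdiff \<beta> f)))"

definition supnorm :: "(real^'n::finite) set \<Rightarrow> (real^'n \<Rightarrow> 'b::real_normed_vector) \<Rightarrow> real" where
  "supnorm \<Omega> g = Sup ((\<lambda>x. norm (g x)) ` \<Omega>)"

text \<open>[f]_{k,alpha}: Hoelder seminorm of the k-th order derivatives.\<close>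
definition holder_seminorm :: "(real^'n::finite) set \<Rightarrow> nat \<Rightarrow> real \<Rightarrow> (real^'n \<Rightarrow> 'b::real_normed_vector) \<Rightarrow> real" where
  "holder_seminorm \<Omega> k \<alpha> f = (\<Sum>\<beta>\<in>{\<beta>::'n list. length \<beta> = k}. holder_semi \<Omega> \<alpha> (pdiff \<beta> f))"

text \<open>||f||_{k+alpha}; ||f||_alpha is the case k = 0.\<close>
definition holder_norm :: "(real^'n::finite) set \<Rightarrow> nat \<Rightarrow> real \<Rightarrow> (real^'n \<Rightarrow> 'b::real_normed_vector) \<Rightarrow> real" where
  "holder_norm \<Omega> k \<alpha> f =
     (\<Sum>m\<le>k. \<Sum>\<beta>\<in>{\<beta>::'n list. length \<beta> = m}. supnorm \<Omega> (pdiff \<beta> f)) + holder_seminorm \<Omega> k \<alpha> f"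

text \<open>C^2 boundary via local C^2 defining functions with nonvanishing gradient.\<close>
definition C2_boundary :: "(real^'n::finite) set \<Rightarrow> bool" where
  "C2_boundary \<Omega> \<longleftrightarrow> (\<forall>x\<in>frontier \<Omega>. \<exists>r>0. \<exists>\<rho>::real^'n \<Rightarrow> real.
      Ck_on 2 (ball x r) \<rho> \<and> (\<forall>y\<in>ball x r. \<exists>i. pdir i \<rho> y \<noteq> 0) \<and>
      \<Omega> \<inter> ball x r = {y \<in> ball x r. \<rho> y < 0})"

definition tensor_sq :: "real^'n \<Rightarrow> real^'n^'n" where
  "tensor_sq \<xi> = (\<chi> i j. \<xi> $ i * \<xi> $ j)"

definition symm_part :: "real^'n^'n \<Rightarrow> real^'n^'n" where
  "symm_part B = (1/2) *\<^sub>R (B + transpose B)"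

end

theory Submission
  imports Defs
begin

text \<open>Let \<open>l\<^sub>i\<close> be the coordinate functionals of the basis \<open>\<xi>\<^sub>i \<otimes> \<xi>\<^sub>i\<close>, so that
  \<open>\<bar>l\<^sub>i u\<bar> \<le> K \<bar>u\<bar>\<close>. With \<open>s = 2 K sup \<bar>D\<bar>\<close> and the constant symmetric matrix
  \<open>G = s \<Sum>\<^sub>i \<xi>\<^sub>i \<otimes> \<xi>\<^sub>i\<close> we get \<open>D + G = \<Sum>\<^sub>i (l\<^sub>i D + s) \<xi>\<^sub>i \<otimes> \<xi>\<^sub>i\<close>, where every coefficient is at
  least \<open>K sup \<bar>D\<bar>\<close>. Hence \<open>a\<^sub>i = sqrt (l\<^sub>i D + s)\<close> is as regular as \<open>D\<close>, the linear map
  \<open>\<Phi> x = G x\<close> has \<open>Sym \<nabla>\<Phi> = G\<close>, and all norms of \<open>G\<close> and \<open>\<Phi>\<close> are bounded by a multiple of \<open>sup \<bar>D\<bar>\<close>.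

  The regularity of \<open>a\<^sub>i\<close> needs \<open>C\<^sup>k\<^sup>,\<^sup>\<alpha>\<close> to be closed under sums, products, inverses and square
  roots of functions bounded away from 0, and the lower-order terms of these rules need
  \<open>C\<^sup>k\<^sup>+\<^sup>1\<^sup>,\<^sup>\<alpha> \<subseteq> C\<^sup>k\<^sup>,\<^sup>\<alpha>\<close>: functions with bounded first partial derivatives must be Hoelder on
  \<open>\<Omega>\<close>. This is where the \<open>C\<^sup>2\<close> boundary enters. Near a boundary point \<open>\<Omega>\<close> is \<open>{\<rho> < 0}\<close> with
  \<open>\<partial>\<^sub>k \<rho>\<close> bounded away from 0, so two nearby points pushed inward along \<open>\<plusminus>e\<^sub>k\<close> span a coordinate
  box inside \<open>\<Omega>\<close>; this gives a local Lipschitz bound, and compactness of the closure makes it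
  global.\<close>

section \<open>Partial derivatives\<close>

lemma pdiff_append: "pdiff (\<beta> @ [i]) f = pdiff \<beta> (pdir i f)"
  by (induction \<beta>) auto

lemma eventually_line_in_open:
  fixes x v :: "'a::real_normed_vector"
  assumes "open S" "x \<in> S"
  shows "\<forall>\<^sub>F t in nhds 0. x + t *\<^sub>R v \<in> S"
proof -
  have "((\<lambda>t::real. x + t *\<^sub>R v) \<longlongrightarrow> x + 0 *\<^sub>R v) (nhds 0)"
    by (intro tendsto_intros filterlim_ident)
  then show ?thesis
    using topological_tendstoD assms by fastforce
qed

lemma has_vector_derivative_line_cong:
  fixes x v :: "'a::real_normed_vector"
  assumes "open S" "x \<in> S" "\<And>y. y \<in> S \<Longrightarrow> f y = g y"
  shows "((\<lambda>t. f (x + t *\<^sub>R v)) has_vector_derivative d) (at 0) \<longleftrightarrow>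
         ((\<lambda>t. g (x + t *\<^sub>R v)) has_vector_derivative d) (at 0)"
proof -
  have "\<forall>\<^sub>F t in nhds 0. f (x + t *\<^sub>R v) = g (x + t *\<^sub>R v)"
    using eventually_line_in_open[OF assms(1,2), of v] by (rule eventually_mono) (use assms(3) in auto)
  then show ?thesis
    by (intro has_vector_derivative_cong_ev) (use assms in auto)
qed

lemma pdir_cong:
  assumes "open S" "x \<in> S" "\<And>y. y \<in> S \<Longrightarrow> f y = g y"
  shows "pdir i f x = pdir i g x"
  unfolding pdir_def
  by (rule vector_derivative_cong_eq)
    (use eventually_line_in_open[OF assms(1,2), of "axis i 1"] assms(3) in \<open>auto elim: eventually_mono\<close>)

lemma pdiff_cong:
  assumes "open S" "x \<in> S" "\<And>y. y \<in> S \<Longrightarrow> f y = g y"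
  shows "pdiff \<beta> f x = pdiff \<beta> g x"
  using assms(2)
proof (induction \<beta> arbitrary: x)
  case Nil
  then show ?case using assms(3) by simp
next
  case (Cons i \<beta>)
  then show ?case using pdir_cong[OF assms(1) Cons.prems, of "pdiff \<beta> f" "pdiff \<beta> g"] by simp
qed

lemma pdir_eqI:
  "((\<lambda>t. f (x + t *\<^sub>R axis i 1)) has_vector_derivative d) (at 0) \<Longrightarrow> pdir i f x = d"
  unfolding pdir_def by (rule vector_derivative_at)

lemma pdiff_const: "pdiff \<beta> (\<lambda>x. c) = (\<lambda>x. if \<beta> = [] then c else 0)"
  by (induction \<beta>) (simp_all add: pdir_def vector_derivative_const_at fun_eq_iff)

lemma all_lists_snoc_iff:
  fixes P :: "'a list \<Rightarrow> bool"
  shows "(\<forall>\<beta>. Q (length \<beta>) \<longrightarrow> P \<beta>) \<longleftrightarrow> (Q 0 \<longrightarrow> P []) \<and> (\<forall>i \<gamma>. Q (Suc (length \<gamma>)) \<longrightarrow> P (\<gamma> @ [i]))"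
proof (intro iffI conjI allI impI)
  fix \<beta> :: "'a list"
  assume "(Q 0 \<longrightarrow> P []) \<and> (\<forall>i \<gamma>. Q (Suc (length \<gamma>)) \<longrightarrow> P (\<gamma> @ [i]))" "Q (length \<beta>)"
  then show "P \<beta>" by (cases \<beta> rule: rev_exhaust) auto
qed auto

lemma has_pderivs_upto_cong:
  assumes "open S" "has_pderivs_upto S k f" "\<And>x. x \<in> S \<Longrightarrow> f x = g x"
  shows "has_pderivs_upto S k g"
  unfolding has_pderivs_upto_def
proof (intro allI impI)
  fix \<beta> :: "'a list" and i x
  assume "length \<beta> < k" and x: "x \<in> S"
  then have "((\<lambda>t. pdiff \<beta> f (x + t *\<^sub>R axis i 1)) has_vector_derivative pdiff (i # \<beta>) f x) (at 0)"
    using assms(2) unfolding has_pderivs_upto_def by blast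
  moreover have "pdiff (i # \<beta>) f x = pdiff (i # \<beta>) g x"
    by (rule pdiff_cong[OF assms(1) x assms(3)])
  ultimately show "((\<lambda>t. pdiff \<beta> g (x + t *\<^sub>R axis i 1)) has_vector_derivative pdiff (i # \<beta>) g x) (at 0)"
    using has_vector_derivative_line_cong[OF assms(1) x, of "pdiff \<beta> f" "pdiff \<beta> g"]
      pdiff_cong[OF assms(1) _ assms(3)] by simp
qed

lemma has_pderivs_upto_Suc:
  fixes f :: "real^'a::finite \<Rightarrow> 'b::real_normed_vector"
  shows "has_pderivs_upto S (Suc k) f \<longleftrightarrow> has_pderivs_upto S 1 f \<and> (\<forall>i. has_pderivs_upto S k (pdir i f))"
proof -
  define D where "D g \<beta> \<longleftrightarrow> (\<forall>i x. x \<in> S \<longrightarrow>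
      ((\<lambda>t. pdiff \<beta> g (x + t *\<^sub>R axis i 1)) has_vector_derivative pdiff (i # \<beta>) g x) (at 0))"
    for g :: "real^'a \<Rightarrow> 'b" and \<beta>
  have unfold_D: "has_pderivs_upto S m g \<longleftrightarrow> (\<forall>\<beta>. length \<beta> < m \<longrightarrow> D g \<beta>)" for m g
    unfolding has_pderivs_upto_def D_def by blast
  have D_snoc: "D f (\<gamma> @ [i]) \<longleftrightarrow> D (pdir i f) \<gamma>" for \<gamma> i
    unfolding D_def by (simp add: pdiff_append)
  have "(\<forall>\<beta>. length \<beta> < Suc k \<longrightarrow> D f \<beta>) \<longleftrightarrow> D f [] \<and> (\<forall>i \<gamma>. length \<gamma> < k \<longrightarrow> D f (\<gamma> @ [i]))"
    using all_lists_snoc_iff[where Q="\<lambda>m. m < Suc k" and P="D f"] by simp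
  then show ?thesis
    unfolding unfold_D D_snoc by auto
qed

lemma pdiff_add_const:
  assumes "open S" "has_pderivs_upto S k f"
  shows "length \<beta> \<le> k \<Longrightarrow> x \<in> S \<Longrightarrow> pdiff \<beta> (\<lambda>y. f y + c) x = pdiff \<beta> f x + (if \<beta> = [] then c else 0)"
proof (induction \<beta> arbitrary: x)
  case Nil
  then show ?case by simp
next
  case (Cons i \<beta>)
  define c' where "c' = (if \<beta> = [] then c else 0)"
  have "\<And>y. y \<in> S \<Longrightarrow> pdiff \<beta> (\<lambda>y. f y + c) y = pdiff \<beta> f y + c'"
    using Cons.IH Cons.prems(1) by (simp add: c'_def)
  then have "pdiff (i # \<beta>) (\<lambda>y. f y + c) x = pdir i (\<lambda>y. pdiff \<beta> f y + c') x"
    using pdir_cong[OF assms(1) Cons.prems(2), of "pdiff \<beta> (\<lambda>y. f y + c)"] by simp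
  also have "\<dots> = pdiff (i # \<beta>) f x"
  proof (rule pdir_eqI)
    have "((\<lambda>t. pdiff \<beta> f (x + t *\<^sub>R axis i 1)) has_vector_derivative pdiff (i # \<beta>) f x) (at 0)"
      using assms(2) Cons.prems unfolding has_pderivs_upto_def by auto
    then show "((\<lambda>t. pdiff \<beta> f (x + t *\<^sub>R axis i 1) + c') has_vector_derivative pdiff (i # \<beta>) f x) (at 0)"
      using has_vector_derivative_add[OF _ has_vector_derivative_const[of c']] by fastforce
  qed
  finally show ?case by simp
qed

lemma has_vector_derivative_matrix_vector_line:
  fixes A :: "real^'n::finite^'m::finite"
  shows "((\<lambda>t. A *v (x + t *\<^sub>R axis i 1)) has_vector_derivative A *v axis i 1) (at 0)"
proof -
  have "((\<lambda>t. x + t *\<^sub>R axis i (1::real)) has_vector_derivative axis i 1) (at 0)"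
    by (auto simp: has_vector_derivative_def intro!: derivative_eq_intros)
  then show ?thesis
    by (rule bounded_linear.has_vector_derivative[OF matrix_vector_mul_bounded_linear])
qed

lemma pdir_matrix_vector: "pdir i (\<lambda>x. A *v x) = (\<lambda>x. A *v axis i 1)"
  by (intro ext pdir_eqI has_vector_derivative_matrix_vector_line)

lemma pdiff_matrix_vector_const:
  assumes "\<beta> \<noteq> []"
  obtains c where "pdiff \<beta> (\<lambda>x. A *v x) = (\<lambda>x. c)"
proof (cases \<beta> rule: rev_exhaust)
  case (snoc \<gamma> i)
  then show ?thesis
    using that by (simp add: pdiff_append pdir_matrix_vector pdiff_const)
qed (use assms in simp)

lemma Cinf_closure_matrix_vector: "Cinf_closure S (\<lambda>x. A *v x)"
  unfolding Cinf_closure_def Ck_closure_def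
proof (intro allI conjI impI)
  show "continuous_on (closure S) (\<lambda>x. A *v x)"
    by (rule matrix_vector_mult_linear_continuous_on)
  fix k
  show "has_pderivs_upto S k (\<lambda>x. A *v x)"
    unfolding has_pderivs_upto_def
  proof (intro allI impI)
    fix \<beta> :: "'a list" and i x
    show "((\<lambda>t. pdiff \<beta> (\<lambda>x. A *v x) (x + t *\<^sub>R axis i 1)) has_vector_derivative
        pdiff (i # \<beta>) (\<lambda>x. A *v x) x) (at 0)"
    proof (cases "\<beta> = []")
      case True
      then show ?thesis
        using has_vector_derivative_matrix_vector_line by (simp add: pdir_matrix_vector)
    next
      case False
      then obtain c where "pdiff \<beta> (\<lambda>x. A *v x) = (\<lambda>x. c)"
        by (rule pdiff_matrix_vector_const)
      then show ?thesis
        by (simp add: pdir_def vector_derivative_const_at)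
    qed
  qed
  fix \<beta> :: "'a list"
  show "uniformly_continuous_on S (pdiff \<beta> (\<lambda>x. A *v x))"
  proof (cases "\<beta> = []")
    case True
    then show ?thesis
      using bounded_linear.uniformly_continuous_on[OF matrix_vector_mul_bounded_linear uniformly_continuous_on_id]
      by simp
  next
    case False
    then obtain c where "pdiff \<beta> (\<lambda>x. A *v x) = (\<lambda>x. c)"
      by (rule pdiff_matrix_vector_const)
    then show ?thesis
      by (simp add: uniformly_continuous_on_const)
  qed
qed

section \<open>Hoelder quotients and norms\<close>

lemma holder_quots_cong:
  assumes "\<And>x. x \<in> S \<Longrightarrow> f x = g x"
  shows "holder_quots S \<alpha> f = holder_quots S \<alpha> g"
  unfolding holder_quots_def using assms by (metis (no_types, opaque_lifting))

lemma holder_quots_add_const: "holder_quots S \<alpha> (\<lambda>x. f x + c) = holder_quots S \<alpha> f"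
  unfolding holder_quots_def by simp

lemma bdd_above_holder_quotsI:
  assumes "\<And>x y. x \<in> S \<Longrightarrow> y \<in> S \<Longrightarrow> x \<noteq> y \<Longrightarrow> norm (f x - f y) / dist x y powr \<alpha> \<le> M"
  shows "bdd_above (holder_quots S \<alpha> f)"
  by (rule bdd_aboveI[of _ M]) (auto simp: holder_quots_def intro: assms)

lemma bdd_above_holder_quotsE:
  assumes "bdd_above (holder_quots S \<alpha> f)"
  obtains M where "\<And>x y. x \<in> S \<Longrightarrow> y \<in> S \<Longrightarrow> x \<noteq> y \<Longrightarrow> norm (f x - f y) / dist x y powr \<alpha> \<le> M"
  using assms unfolding bdd_above_def holder_quots_def by blast

lemma holder_quots_nonempty:
  fixes S :: "(real^'n::finite) set"
  assumes "open S" "S \<noteq> {}"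
  shows "holder_quots S \<alpha> f \<noteq> {}"
proof -
  obtain x e where x: "x \<in> S" "e > 0" "ball x e \<subseteq> S"
    using assms open_contains_ball by blast
  obtain i :: 'n where True by simp
  define y where "y = x + (e / 2) *\<^sub>R axis i 1"
  have "y \<in> S" "x \<noteq> y"
    using x by (auto simp: y_def dist_norm norm_axis_1 axis_eq_0_iff subset_iff)
  then show ?thesis
    using x(1) unfolding holder_quots_def by blast
qed

lemma holder_semi_nonneg:
  assumes "bdd_above (holder_quots S \<alpha> f)" "holder_quots S \<alpha> f \<noteq> {}"
  shows "holder_semi S \<alpha> f \<ge> 0"
proof -
  obtain q where "q \<in> holder_quots S \<alpha> f"
    using assms(2) by blast
  moreover have "q \<ge> 0"
    using calculation unfolding holder_quots_def by auto
  ultimately show ?thesis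
    unfolding holder_semi_def using assms(1) cSup_upper order_trans by blast
qed

lemma holder_semi_le:
  assumes "holder_quots S \<alpha> f \<noteq> {}"
    and "\<And>x y. x \<in> S \<Longrightarrow> y \<in> S \<Longrightarrow> x \<noteq> y \<Longrightarrow> norm (f x - f y) / dist x y powr \<alpha> \<le> B"
  shows "holder_semi S \<alpha> f \<le> B"
  unfolding holder_semi_def
  by (rule cSup_least[OF assms(1)]) (use assms(2) in \<open>auto simp: holder_quots_def\<close>)

lemma supnorm_cong: "(\<And>x. x \<in> S \<Longrightarrow> f x = g x) \<Longrightarrow> supnorm S f = supnorm S g"
  unfolding supnorm_def by (metis (mono_tags, lifting) image_cong)

lemma supnorm_upper:
  assumes "bounded (f ` S)" "x \<in> S"
  shows "norm (f x) \<le> supnorm S f"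
proof -
  have "bdd_above ((\<lambda>x. norm (f x)) ` S)"
    using assms(1) unfolding bounded_iff bdd_above_def by fast
  then show ?thesis
    unfolding supnorm_def using assms(2) by (rule cSUP_upper2) simp
qed

lemma supnorm_le: "S \<noteq> {} \<Longrightarrow> (\<And>x. x \<in> S \<Longrightarrow> norm (f x) \<le> B) \<Longrightarrow> supnorm S f \<le> B"
  unfolding supnorm_def by (rule cSUP_least)

lemma supnorm_nonneg: "bounded (f ` S) \<Longrightarrow> x \<in> S \<Longrightarrow> supnorm S f \<ge> 0"
  using supnorm_upper norm_ge_zero order_trans by blast

lemma holder_norm_0: "holder_norm S 0 \<alpha> f = supnorm S f + holder_semi S \<alpha> f"
proof -
  have "{\<beta>::'a list. length \<beta> = 0} = {[]}" by auto
  then show ?thesis unfolding holder_norm_def holder_seminorm_def by simp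
qed

lemma holder_seminorm_cong:
  assumes "open S" "\<And>x. x \<in> S \<Longrightarrow> f x = g x"
  shows "holder_seminorm S k \<alpha> f = holder_seminorm S k \<alpha> g"
proof -
  have "holder_quots S \<alpha> (pdiff \<beta> f) = holder_quots S \<alpha> (pdiff \<beta> g)" for \<beta>
    using pdiff_cong[OF assms(1) _ assms(2)] by (rule holder_quots_cong)
  then show ?thesis
    unfolding holder_seminorm_def holder_semi_def by simp
qed

lemma holder_norm_cong:
  assumes "open S" "\<And>x. x \<in> S \<Longrightarrow> f x = g x"
  shows "holder_norm S k \<alpha> f = holder_norm S k \<alpha> g"
proof -
  have "supnorm S (pdiff \<beta> f) = supnorm S (pdiff \<beta> g)" for \<beta>
    using pdiff_cong[OF assms(1) _ assms(2)] by (rule supnorm_cong)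
  then show ?thesis
    unfolding holder_norm_def using holder_seminorm_cong[OF assms] by simp
qed

lemma holder_seminorm_add_const:
  assumes "open S" "has_pderivs_upto S k f"
  shows "holder_seminorm S k \<alpha> (\<lambda>x. f x + c) = holder_seminorm S k \<alpha> f"
  unfolding holder_seminorm_def
proof (rule sum.cong[OF refl])
  fix \<beta> :: "'a list"
  assume "\<beta> \<in> {\<beta>. length \<beta> = k}"
  then have "holder_quots S \<alpha> (pdiff \<beta> (\<lambda>x. f x + c)) =
      holder_quots S \<alpha> (\<lambda>x. pdiff \<beta> f x + (if \<beta> = [] then c else 0))"
    using pdiff_add_const[OF assms] by (intro holder_quots_cong) auto
  then show "holder_semi S \<alpha> (pdiff \<beta> (\<lambda>x. f x + c)) = holder_semi S \<alpha> (pdiff \<beta> f)"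
    by (simp add: holder_semi_def holder_quots_add_const)
qed

lemma holder_norm_0_add_const_le:
  assumes "S \<noteq> {}" "bounded (f ` S)"
  shows "holder_norm S 0 \<alpha> (\<lambda>x. f x + c) \<le> holder_norm S 0 \<alpha> f + norm c"
proof -
  have "supnorm S (\<lambda>x. f x + c) \<le> supnorm S f + norm c"
  proof (rule supnorm_le[OF assms(1)])
    fix x
    assume "x \<in> S"
    then show "norm (f x + c) \<le> supnorm S f + norm c"
      using norm_triangle_ineq[of "f x" c] supnorm_upper[OF assms(2)] by fastforce
  qed
  then show ?thesis
    by (simp add: holder_norm_0 holder_semi_def holder_quots_add_const)
qed

lemma div_powr_le:
  fixes d \<alpha> :: real
  assumes "d > 0" "0 \<le> \<alpha>" "\<alpha> \<le> 1"
  shows "d / d powr \<alpha> \<le> 1 + d"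
proof (cases "d \<le> 1")
  case True
  then have "d powr 1 \<le> d powr \<alpha>"
    using assms by (intro powr_mono') auto
  then have "d / d powr \<alpha> \<le> 1"
    using assms by (simp add: divide_le_eq)
  then show ?thesis
    using assms by linarith
next
  case False
  then have "1 \<le> d powr \<alpha>"
    using assms by (intro ge_one_powr_ge_zero) auto
  then have "d / d powr \<alpha> \<le> d"
    using assms by (simp add: divide_le_eq mult_le_cancel_left1)
  then show ?thesis by simp
qed

lemma holder_norm_0_matrix_vector_le:
  fixes A :: "real^'n::finite^'m::finite"
  assumes "holder_quots S \<alpha> (\<lambda>x. A *v x) \<noteq> {}" "\<And>x. x \<in> S \<Longrightarrow> norm x \<le> R" "0 \<le> \<alpha>" "\<alpha> \<le> 1"
  shows "holder_norm S 0 \<alpha> (\<lambda>x. A *v x) \<le> onorm ((*v) A) * (1 + 3 * R)"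
proof -
  let ?\<omega> = "onorm ((*v) A)"
  have \<omega>: "norm (A *v x) \<le> ?\<omega> * norm x" for x
    by (rule onorm[OF matrix_vector_mul_bounded_linear])
  have "?\<omega> \<ge> 0"
    by (rule onorm_pos_le[OF matrix_vector_mul_bounded_linear])
  have "S \<noteq> {}"
    using assms(1) by (auto simp: holder_quots_def)
  then have "supnorm S (\<lambda>x. A *v x) \<le> ?\<omega> * R"
    by (rule supnorm_le) (use \<omega> assms(2) \<open>?\<omega> \<ge> 0\<close> in \<open>meson mult_left_mono order_trans\<close>)
  moreover have "holder_semi S \<alpha> (\<lambda>x. A *v x) \<le> ?\<omega> * (1 + 2 * R)"
  proof (rule holder_semi_le[OF assms(1)])
    fix x y
    assume xy: "x \<in> S" "y \<in> S" "x \<noteq> y"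
    have d: "dist x y > 0" "dist x y \<le> 2 * R"
      using xy assms(2)[of x] assms(2)[of y] norm_triangle_ineq4[of x y] by (auto simp: dist_norm)
    have "norm (A *v x - A *v y) \<le> ?\<omega> * dist x y"
      using \<omega>[of "x - y"] by (simp add: matrix_vector_mult_diff_distrib dist_norm)
    then have "norm (A *v x - A *v y) / dist x y powr \<alpha> \<le> ?\<omega> * (dist x y / dist x y powr \<alpha>)"
      using d(1) by (simp add: divide_right_mono)
    also have "\<dots> \<le> ?\<omega> * (1 + 2 * R)"
      using div_powr_le[OF d(1) assms(3,4)] d(2) \<open>?\<omega> \<ge> 0\<close> by (intro mult_left_mono) auto
    finally show "norm (A *v x - A *v y) / dist x y powr \<alpha> \<le> ?\<omega> * (1 + 2 * R)" .
  qed
  ultimately show ?thesis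
    by (simp add: holder_norm_0 algebra_simps)
qed

section \<open>Hoelder classes on open sets\<close>

definition holder_on :: "(real^'n::finite) set \<Rightarrow> real \<Rightarrow> nat \<Rightarrow> (real^'n \<Rightarrow> 'b::real_normed_vector) \<Rightarrow> bool" where
  "holder_on S \<alpha> k f \<longleftrightarrow> has_pderivs_upto S k f \<and>
     (\<forall>\<beta>. length \<beta> \<le> k \<longrightarrow> uniformly_continuous_on S (pdiff \<beta> f)) \<and>
     (\<forall>\<beta>. length \<beta> = k \<longrightarrow> bdd_above (holder_quots S \<alpha> (pdiff \<beta> f)))"

lemma holder_space_iff: "holder_space S k \<alpha> f \<longleftrightarrow> continuous_on (closure S) f \<and> holder_on S \<alpha> k f"
  unfolding holder_space_def holder_on_def Ck_closure_def by auto

lemma holder_on_0_iff: "holder_on S \<alpha> 0 f \<longleftrightarrow> uniformly_continuous_on S f \<and> bdd_above (holder_quots S \<alpha> f)"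
  unfolding holder_on_def has_pderivs_upto_def by auto

lemma holder_on_uniformly_continuous: "holder_on S \<alpha> k f \<Longrightarrow> uniformly_continuous_on S f"
  unfolding holder_on_def by (metis le0 list.size(3) pdiff.simps(1))

lemma holder_on_Suc_iff:
  "holder_on S \<alpha> (Suc k) f \<longleftrightarrow>
     has_pderivs_upto S 1 f \<and> uniformly_continuous_on S f \<and> (\<forall>i. holder_on S \<alpha> k (pdir i f))"
proof -
  have uc: "(\<forall>\<beta>. length \<beta> \<le> Suc k \<longrightarrow> uniformly_continuous_on S (pdiff \<beta> f)) \<longleftrightarrow>
      uniformly_continuous_on S f \<and> (\<forall>i \<beta>. length \<beta> \<le> k \<longrightarrow> uniformly_continuous_on S (pdiff \<beta> (pdir i f)))"
    using all_lists_snoc_iff[where Q="\<lambda>m. m \<le> Suc k" and P="\<lambda>\<beta>. uniformly_continuous_on S (pdiff \<beta> f)"]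
    by (simp add: pdiff_append)
  have hq: "(\<forall>\<beta>. length \<beta> = Suc k \<longrightarrow> bdd_above (holder_quots S \<alpha> (pdiff \<beta> f))) \<longleftrightarrow>
      (\<forall>i \<beta>. length \<beta> = k \<longrightarrow> bdd_above (holder_quots S \<alpha> (pdiff \<beta> (pdir i f))))"
    using all_lists_snoc_iff[where Q="\<lambda>m. m = Suc k" and P="\<lambda>\<beta>. bdd_above (holder_quots S \<alpha> (pdiff \<beta> f))"]
    by (simp add: pdiff_append)
  show ?thesis
    unfolding holder_on_def has_pderivs_upto_Suc[of S k f] uc hq by auto
qed

lemma uniformly_continuous_on_cong:
  fixes f g :: "'a::metric_space \<Rightarrow> 'b::metric_space"
  assumes "\<And>x. x \<in> S \<Longrightarrow> f x = g x"
  shows "uniformly_continuous_on S f \<longleftrightarrow> uniformly_continuous_on S g"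
  unfolding uniformly_continuous_on_def using assms by (metis (no_types, lifting))

lemma holder_on_cong:
  assumes "open S" "holder_on S \<alpha> k f" "\<And>x. x \<in> S \<Longrightarrow> f x = g x"
  shows "holder_on S \<alpha> k g"
proof -
  have "\<And>\<beta> x. x \<in> S \<Longrightarrow> pdiff \<beta> f x = pdiff \<beta> g x"
    using pdiff_cong[OF assms(1) _ assms(3)] .
  then have "uniformly_continuous_on S (pdiff \<beta> f) \<longleftrightarrow> uniformly_continuous_on S (pdiff \<beta> g)"
    and "holder_quots S \<alpha> (pdiff \<beta> f) = holder_quots S \<alpha> (pdiff \<beta> g)" for \<beta>
    by (auto intro!: uniformly_continuous_on_cong holder_quots_cong)
  then show ?thesis
    using assms(2) has_pderivs_upto_cong[OF assms(1) _ assms(3)] unfolding holder_on_def by auto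
qed

lemma holder_on_SucD:
  "holder_on S \<alpha> (Suc k) f \<Longrightarrow> x \<in> S \<Longrightarrow>
     ((\<lambda>t. f (x + t *\<^sub>R axis i 1)) has_vector_derivative pdir i f x) (at 0)"
  unfolding holder_on_Suc_iff has_pderivs_upto_def by force

lemma holder_on_SucD_real:
  fixes f :: "real^'n::finite \<Rightarrow> real"
  shows "holder_on S \<alpha> (Suc k) f \<Longrightarrow> x \<in> S \<Longrightarrow>
     ((\<lambda>t. f (x + t *\<^sub>R axis i 1)) has_real_derivative pdir i f x) (at 0)"
  unfolding has_real_derivative_iff_has_vector_derivative by (rule holder_on_SucD)

lemma holder_on_SucI:
  assumes "open S"
    and "\<And>i x. x \<in> S \<Longrightarrow> ((\<lambda>t. f (x + t *\<^sub>R axis i 1)) has_vector_derivative f' i x) (at 0)"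
    and "uniformly_continuous_on S f" and "\<And>i. holder_on S \<alpha> k (f' i)"
  shows "holder_on S \<alpha> (Suc k) f"
proof -
  have "pdir i f x = f' i x" if "x \<in> S" for i x
    using pdir_eqI[OF assms(2)[OF that]] .
  then show ?thesis
    unfolding holder_on_Suc_iff has_pderivs_upto_def
    using assms holder_on_cong[OF assms(1) assms(4)] by auto
qed

lemma holder_on_const: "open S \<Longrightarrow> holder_on S \<alpha> k (\<lambda>x. c)"
proof (induction k arbitrary: c)
  case 0
  then show ?case
    unfolding holder_on_0_iff by (auto intro!: bdd_above_holder_quotsI[of S _ \<alpha> 0] uniformly_continuous_on_const)
next
  case (Suc k)
  then show ?case
    by (intro holder_on_SucI[where f'="\<lambda>i x. 0"]) (auto intro: uniformly_continuous_on_const)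
qed

lemma uniformly_continuous_on_dominated:
  fixes f :: "'a::metric_space \<Rightarrow> 'b::real_normed_vector" and g :: "'a \<Rightarrow> 'c::real_normed_vector"
    and F :: "'a \<Rightarrow> 'd::real_normed_vector"
  assumes "uniformly_continuous_on S f" "uniformly_continuous_on S g" "a \<ge> 0" "b \<ge> 0"
    and dom: "\<And>x y. x \<in> S \<Longrightarrow> y \<in> S \<Longrightarrow> norm (F x - F y) \<le> a * norm (f x - f y) + b * norm (g x - g y)"
  shows "uniformly_continuous_on S F"
  unfolding uniformly_continuous_on_def
proof (intro allI impI)
  fix e :: real
  assume "e > 0"
  define e' where "e' = e / (a + b + 1)"
  have e': "e' > 0" "(a + b) * e' < e"
    using \<open>e > 0\<close> assms(3,4) by (auto simp: e'_def field_simps)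
  obtain d1 where d1: "d1 > 0" "\<forall>x\<in>S. \<forall>x'\<in>S. dist x' x < d1 \<longrightarrow> dist (f x') (f x) < e'"
    using assms(1) e'(1) unfolding uniformly_continuous_on_def by blast
  obtain d2 where d2: "d2 > 0" "\<forall>x\<in>S. \<forall>x'\<in>S. dist x' x < d2 \<longrightarrow> dist (g x') (g x) < e'"
    using assms(2) e'(1) unfolding uniformly_continuous_on_def by blast
  have "dist (F x') (F x) < e" if "x \<in> S" "x' \<in> S" "dist x' x < min d1 d2" for x x'
  proof -
    have "a * norm (f x' - f x) \<le> a * e'" "b * norm (g x' - g x) \<le> b * e'"
      using d1 d2 that assms(3,4) by (auto intro!: mult_left_mono simp: dist_norm less_imp_le)
    then show ?thesis
      using dom[OF that(2,1)] e'(2) by (simp add: dist_norm algebra_simps)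
  qed
  then show "\<exists>d>0. \<forall>x\<in>S. \<forall>x'\<in>S. dist x' x < d \<longrightarrow> dist (F x') (F x) < e"
    using d1(1) d2(1) by (metis min_less_iff_conj)
qed

lemma bdd_above_holder_quots_dominated:
  assumes "bdd_above (holder_quots S \<alpha> f)" "bdd_above (holder_quots S \<alpha> g)" "a \<ge> 0" "b \<ge> 0"
    and dom: "\<And>x y. x \<in> S \<Longrightarrow> y \<in> S \<Longrightarrow> norm (F x - F y) \<le> a * norm (f x - f y) + b * norm (g x - g y)"
  shows "bdd_above (holder_quots S \<alpha> F)"
proof -
  obtain Mf Mg where
    Mf: "\<And>x y. x \<in> S \<Longrightarrow> y \<in> S \<Longrightarrow> x \<noteq> y \<Longrightarrow> norm (f x - f y) / dist x y powr \<alpha> \<le> Mf" and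
    Mg: "\<And>x y. x \<in> S \<Longrightarrow> y \<in> S \<Longrightarrow> x \<noteq> y \<Longrightarrow> norm (g x - g y) / dist x y powr \<alpha> \<le> Mg"
    using bdd_above_holder_quotsE[OF assms(1)] bdd_above_holder_quotsE[OF assms(2)] by metis
  show ?thesis
  proof (rule bdd_above_holder_quotsI)
    fix x y
    assume xy: "x \<in> S" "y \<in> S" "x \<noteq> y"
    have "norm (F x - F y) / dist x y powr \<alpha> \<le>
        a * (norm (f x - f y) / dist x y powr \<alpha>) + b * (norm (g x - g y) / dist x y powr \<alpha>)"
      using dom[OF xy(1,2)] xy(3) by (simp add: divide_right_mono add_divide_distrib[symmetric])
    also have "\<dots> \<le> a * Mf + b * Mg"
      using Mf[OF xy] Mg[OF xy] assms(3,4) by (intro add_mono mult_left_mono)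
    finally show "norm (F x - F y) / dist x y powr \<alpha> \<le> a * Mf + b * Mg" .
  qed
qed

lemma holder_on_0_dominated:
  assumes "holder_on S \<alpha> 0 f" "holder_on S \<alpha> 0 g" "a \<ge> 0" "b \<ge> 0"
    and "\<And>x y. x \<in> S \<Longrightarrow> y \<in> S \<Longrightarrow> norm (F x - F y) \<le> a * norm (f x - f y) + b * norm (g x - g y)"
  shows "holder_on S \<alpha> 0 F"
  using assms uniformly_continuous_on_dominated[of S f g a b F]
    bdd_above_holder_quots_dominated[of S \<alpha> f g a b F]
  unfolding holder_on_0_iff by simp

lemma holder_on_0_lipschitz_comp:
  assumes "holder_on S \<alpha> 0 f" "a \<ge> 0"
    and "\<And>x y. x \<in> S \<Longrightarrow> y \<in> S \<Longrightarrow> norm (F x - F y) \<le> a * norm (f x - f y)"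
  shows "holder_on S \<alpha> 0 F"
  by (rule holder_on_0_dominated[OF assms(1,1,2) order_refl]) (simp add: assms(3))

section \<open>Lipschitz bounds from bounded partial derivatives\<close>

lemma has_vector_derivative_line_shift:
  fixes f :: "'a::real_normed_vector \<Rightarrow> 'b::real_normed_vector"
  assumes "((\<lambda>\<tau>. f (x + t *\<^sub>R u + \<tau> *\<^sub>R u)) has_vector_derivative d) (at 0)"
  shows "((\<lambda>s. f (x + s *\<^sub>R u)) has_vector_derivative d) (at t)"
proof -
  have "((\<lambda>s. s - t) has_vector_derivative 1) (at t)"
    by (auto intro!: derivative_eq_intros simp: has_real_derivative_iff_has_vector_derivative[symmetric])
  moreover have "((\<lambda>\<tau>. f (x + t *\<^sub>R u + \<tau> *\<^sub>R u)) has_vector_derivative d) (at ((\<lambda>s. s - t) t))"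
    using assms by simp
  ultimately have "((\<lambda>\<tau>. f (x + t *\<^sub>R u + \<tau> *\<^sub>R u)) \<circ> (\<lambda>s. s - t) has_vector_derivative 1 *\<^sub>R d) (at t)"
    by (rule vector_diff_chain_at)
  moreover have "(\<lambda>\<tau>. f (x + t *\<^sub>R u + \<tau> *\<^sub>R u)) \<circ> (\<lambda>s. s - t) = (\<lambda>s. f (x + s *\<^sub>R u))"
    by (auto simp: fun_eq_iff algebra_simps)
  ultimately show ?thesis by simp
qed

lemma has_vector_derivative_line_scale:
  fixes f :: "'a::real_normed_vector \<Rightarrow> 'b::real_normed_vector"
  assumes "((\<lambda>t. f (x + t *\<^sub>R u)) has_vector_derivative d) (at 0)"
  shows "((\<lambda>t. f (x + t *\<^sub>R (m *\<^sub>R u))) has_vector_derivative m *\<^sub>R d) (at 0)"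
proof -
  have "((\<lambda>t. m * t) has_vector_derivative m) (at 0)"
    by (auto intro!: derivative_eq_intros simp: has_real_derivative_iff_has_vector_derivative[symmetric])
  moreover have "((\<lambda>t. f (x + t *\<^sub>R u)) has_vector_derivative d) (at ((\<lambda>t. m * t) 0))"
    using assms by simp
  ultimately have "((\<lambda>t. f (x + t *\<^sub>R u)) \<circ> (\<lambda>t. m * t) has_vector_derivative m *\<^sub>R d) (at 0)"
    by (rule vector_diff_chain_at)
  then show ?thesis by (simp add: o_def mult.commute)
qed

lemma norm_diff_le_along_line:
  fixes f :: "'a::real_normed_vector \<Rightarrow> 'b::real_normed_vector"
  assumes deriv: "\<And>y. y \<in> S \<Longrightarrow> ((\<lambda>t. f (y + t *\<^sub>R u)) has_vector_derivative f' y) (at 0)"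
    and bound: "\<And>y. y \<in> S \<Longrightarrow> norm (f' y) \<le> L"
    and segment: "\<And>t. t \<in> closed_segment 0 \<delta> \<Longrightarrow> x + t *\<^sub>R u \<in> S"
  shows "norm (f (x + \<delta> *\<^sub>R u) - f x) \<le> L * \<bar>\<delta>\<bar>"
proof -
  have "((\<lambda>s. f (x + s *\<^sub>R u)) has_derivative (\<lambda>h. h *\<^sub>R f' (x + t *\<^sub>R u))) (at t within closed_segment 0 \<delta>)"
    if "t \<in> closed_segment 0 \<delta>" for t
    using has_vector_derivative_line_shift[OF deriv[OF segment[OF that]]]
    unfolding has_vector_derivative_def by (rule has_derivative_at_withinI)
  moreover have "onorm (\<lambda>h::real. h *\<^sub>R f' (x + t *\<^sub>R u)) \<le> L" if "t \<in> closed_segment 0 \<delta>" for t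
    using bound[OF segment[OF that]] onorm_scaleR_left[OF bounded_linear_ident, of "f' (x + t *\<^sub>R u)"]
    by (simp add: onorm_id)
  ultimately have "norm (f (x + \<delta> *\<^sub>R u) - f (x + 0 *\<^sub>R u)) \<le> L * norm (\<delta> - 0)"
    by (intro differentiable_bound[of "closed_segment 0 \<delta>"]) auto
  then show ?thesis by simp
qed

lemma mem_coord_box:
  fixes x y w :: "real^'n::finite"
  shows "w \<in> cbox (inf x y) (sup x y) \<longleftrightarrow> (\<forall>i. min (x$i) (y$i) \<le> w$i \<and> w$i \<le> max (x$i) (y$i))"
  by (simp add: mem_box_cart inf_vec_def sup_vec_def inf_min sup_max)

lemma coord_box_subset:
  fixes x y w :: "real^'n::finite"
  assumes "w \<in> cbox (inf x y) (sup x y)"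
  shows "cbox (inf x w) (sup x w) \<subseteq> cbox (inf x y) (sup x y)"
  using assms unfolding subset_iff mem_coord_box by (smt (verit))

lemma dist_le_coord_box:
  fixes x y w :: "real^'n::finite"
  assumes "w \<in> cbox (inf x y) (sup x y)"
  shows "dist x w \<le> dist x y"
  unfolding dist_vec_def dist_real_def
proof (rule L2_set_mono)
  fix i
  have "min (x$i) (y$i) \<le> w$i \<and> w$i \<le> max (x$i) (y$i)"
    using assms mem_coord_box by blast
  then show "\<bar>x$i - w$i\<bar> \<le> \<bar>x$i - y$i\<bar>"
    by (auto simp: min_def max_def abs_if split: if_splits)
qed simp

lemma sum_abs_diff_le_card_dist:
  fixes x y :: "real^'n::finite"
  shows "(\<Sum>i\<in>UNIV. \<bar>y$i - x$i\<bar>) \<le> CARD('n) * dist x y"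
proof -
  have "(\<Sum>i\<in>UNIV. \<bar>y$i - x$i\<bar>) \<le> of_nat (card (UNIV::'n set)) * dist x y"
    by (rule sum_bounded_above)
      (metis component_le_norm_cart dist_norm norm_minus_commute vector_minus_component)
  then show ?thesis by simp
qed

lemma norm_diff_le_coord_box:
  fixes f :: "real^'n::finite \<Rightarrow> 'b::real_normed_vector" and M :: real
  assumes deriv: "\<And>w i. w \<in> S \<Longrightarrow> ((\<lambda>t. f (w + t *\<^sub>R axis i 1)) has_vector_derivative pdir i f w) (at 0)"
    and bound: "\<And>w i. w \<in> S \<Longrightarrow> norm (pdir i f w) \<le> M" and "M \<ge> 0"
    and box: "cbox (inf x y) (sup x y) \<subseteq> S"
  shows "norm (f y - f x) \<le> CARD('n) * M * dist x y"
proof -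
  define z where "z J = (\<chi> k. if k \<in> J then y$k else x$k)" for J
  have step: "norm (f (z (insert i J)) - f (z J)) \<le> M * \<bar>y$i - x$i\<bar>" if "i \<notin> J" for i J
  proof -
    have "z J + t *\<^sub>R axis i 1 \<in> S" if "t \<in> closed_segment 0 (y$i - x$i)" for t
      using that \<open>i \<notin> J\<close> box
      by (auto simp: subset_iff mem_coord_box z_def axis_def closed_segment_eq_real_ivl split: if_splits)
    then have "norm (f (z J + (y$i - x$i) *\<^sub>R axis i 1) - f (z J)) \<le> M * \<bar>y$i - x$i\<bar>"
      by (intro norm_diff_le_along_line[where S=S and f'="pdir i f"]) (use deriv bound in auto)
    moreover have "z (insert i J) = z J + (y$i - x$i) *\<^sub>R axis i 1"
      using that by (auto simp: z_def axis_def vec_eq_iff)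
    ultimately show ?thesis by simp
  qed
  have "norm (f (z J) - f x) \<le> M * (\<Sum>k\<in>J. \<bar>y$k - x$k\<bar>)" for J
  proof (induction J rule: finite_induct[OF finite])
    case 1
    then show ?case by (simp add: z_def)
  next
    case (2 i J)
    then show ?case
      using norm_diff_triangle_le[OF step[OF 2(2)] 2(3)] by (simp add: distrib_left)
  qed
  from this[of UNIV] have "norm (f y - f x) \<le> M * (\<Sum>k\<in>UNIV. \<bar>y$k - x$k\<bar>)"
    by (simp add: z_def)
  also have "\<dots> \<le> M * (CARD('n) * dist x y)"
    using sum_abs_diff_le_card_dist \<open>M \<ge> 0\<close> by (rule mult_left_mono)
  finally show ?thesis by (simp add: mult_ac)
qed

lemma lipschitz_near_interior_point:
  fixes f :: "real^'n::finite \<Rightarrow> 'b::real_normed_vector" and M :: real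
  assumes "ball p r \<subseteq> \<Omega>"
    and deriv: "\<And>w i. w \<in> \<Omega> \<Longrightarrow> ((\<lambda>t. f (w + t *\<^sub>R axis i 1)) has_vector_derivative pdir i f w) (at 0)"
    and bound: "\<And>w i. w \<in> \<Omega> \<Longrightarrow> norm (pdir i f w) \<le> M" and "M \<ge> 0"
    and "x \<in> ball p (r / 3)" "y \<in> ball p (r / 3)"
  shows "norm (f x - f y) \<le> CARD('n) * M * dist x y"
proof -
  have "dist p w < r" if "w \<in> cbox (inf y x) (sup y x)" for w
    using dist_le_coord_box[OF that] assms(5,6) dist_triangle[of p w y] dist_triangle[of y x p]
    by (auto simp: dist_commute)
  then have "cbox (inf y x) (sup y x) \<subseteq> \<Omega>"
    using assms(1) by auto
  then have "norm (f x - f y) \<le> CARD('n) * M * dist y x"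
    using norm_diff_le_coord_box[OF deriv bound \<open>M \<ge> 0\<close>] by blast
  then show ?thesis by (simp add: dist_commute)
qed

lemma uniform_lipschitz_radius:
  fixes f :: "'a::heine_borel \<Rightarrow> 'b::real_normed_vector"
  assumes "bounded S"
    and local: "\<And>p. p \<in> closure S \<Longrightarrow>
      \<exists>r>0. \<exists>A. \<forall>x\<in>S \<inter> ball p r. \<forall>y\<in>S \<inter> ball p r. norm (f x - f y) \<le> A * dist x y"
  obtains e A where "e > 0" "\<And>x y. x \<in> S \<Longrightarrow> y \<in> S \<Longrightarrow> dist x y < e \<Longrightarrow> norm (f x - f y) \<le> A * dist x y"
proof -
  obtain R A where R: "\<And>p. p \<in> closure S \<Longrightarrow> R p > 0"
    and A: "\<And>p x y. p \<in> closure S \<Longrightarrow> x \<in> S \<inter> ball p (R p) \<Longrightarrow> y \<in> S \<inter> ball p (R p) \<Longrightarrow>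
      norm (f x - f y) \<le> A p * dist x y"
    using local by metis
  have cpt: "compact (closure S)"
    using assms(1) by (simp add: compact_eq_bounded_closed bounded_closure)
  obtain C where C: "C \<subseteq> closure S" "finite C" "closure S \<subseteq> (\<Union>p\<in>C. ball p (R p))"
  proof (rule compactE_image[OF cpt, of "closure S" "\<lambda>p. ball p (R p)"])
    show "closure S \<subseteq> (\<Union>p\<in>closure S. ball p (R p))"
      using R by force
  qed auto
  obtain e where e: "e > 0" "\<And>x. x \<in> closure S \<Longrightarrow> \<exists>G\<in>(\<lambda>p. ball p (R p)) ` C. ball x e \<subseteq> G"
    by (rule Heine_Borel_lemma[OF cpt]) (use C(3) in auto)
  show ?thesis
  proof (rule that[OF e(1)])
    fix x y
    assume xy: "x \<in> S" "y \<in> S" "dist x y < e"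
    then obtain p where p: "p \<in> C" "ball x e \<subseteq> ball p (R p)"
      using e(2) closure_subset by blast
    moreover have "x \<in> ball x e" "y \<in> ball x e"
      using xy(3) e(1) by (auto simp: dist_commute)
    ultimately have "norm (f x - f y) \<le> A p * dist x y"
      using A[of p x y] C(1) xy(1,2) by blast
    also have "\<dots> \<le> (\<Sum>q\<in>C. \<bar>A q\<bar>) * dist x y"
      using member_le_sum[of p C "\<lambda>q. \<bar>A q\<bar>"] p(1) C(2) by (intro mult_right_mono) auto
    finally show "norm (f x - f y) \<le> (\<Sum>q\<in>C. \<bar>A q\<bar>) * dist x y" .
  qed
qed

lemma bdd_above_holder_quots_small_scale_lipschitz:
  fixes f :: "real^'n::finite \<Rightarrow> 'b::real_normed_vector"
  assumes "e > 0" "0 \<le> \<alpha>" "\<alpha> \<le> 1"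
    and bounded: "\<And>x. x \<in> S \<Longrightarrow> norm (f x) \<le> B"
    and lipschitz: "\<And>x y. x \<in> S \<Longrightarrow> y \<in> S \<Longrightarrow> dist x y < e \<Longrightarrow> norm (f x - f y) \<le> A * dist x y"
  shows "bdd_above (holder_quots S \<alpha> f)"
proof (rule bdd_above_holder_quotsI)
  fix x y
  assume xy: "x \<in> S" "y \<in> S" "x \<noteq> y"
  define d where "d = dist x y"
  define e' where "e' = min e 1"
  have d: "d > 0" and e': "e' > 0" "e' \<le> 1"
    using xy(3) \<open>e > 0\<close> by (auto simp: d_def e'_def)
  show "norm (f x - f y) / dist x y powr \<alpha> \<le> \<bar>A\<bar> + 2 * \<bar>B\<bar> / e' powr \<alpha>"
  proof (cases "d < e'")
    case True
    have "dist x y < e"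
      using True by (simp add: d_def e'_def)
    then have "norm (f x - f y) \<le> A * d"
      using lipschitz xy by (simp add: d_def)
    also have "\<dots> \<le> \<bar>A\<bar> * d"
      using d by (intro mult_right_mono) auto
    also have "\<dots> \<le> \<bar>A\<bar> * d powr \<alpha>"
      using powr_mono'[of \<alpha> 1 d] assms(3) True d e' by (intro mult_left_mono) auto
    finally have "norm (f x - f y) / d powr \<alpha> \<le> \<bar>A\<bar>"
      using d by (simp add: divide_le_eq)
    then show ?thesis
      by (simp add: d_def add_increasing2)
  next
    case False
    have "norm (f x - f y) \<le> 2 * \<bar>B\<bar>"
      using bounded[OF xy(1)] bounded[OF xy(2)] norm_triangle_ineq4[of "f x" "f y"] by linarith
    moreover have "e' powr \<alpha> \<le> d powr \<alpha>"
      using False e' assms(2) by (intro powr_mono2) auto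
    ultimately have "norm (f x - f y) / d powr \<alpha> \<le> 2 * \<bar>B\<bar> / e' powr \<alpha>"
      using e' by (intro frac_le) auto
    then show ?thesis
      by (simp add: d_def add_increasing)
  qed
qed

section \<open>Domains with \<open>C\<^sup>2\<close> boundary\<close>

locale boundary_chart =
  fixes \<Omega> :: "(real^'n::finite) set" and \<rho> :: "real^'n \<Rightarrow> real" and p :: "real^'n"
    and r :: real and k :: 'n and \<sigma> c L :: real
  assumes r_pos: "r > 0" and c_pos: "c > 0" and sign: "\<bar>\<sigma>\<bar> = 1"
    and chart: "\<Omega> \<inter> ball p r = {y \<in> ball p r. \<rho> y < 0}"
    and partials: "\<And>y i. y \<in> ball p r \<Longrightarrow>
      ((\<lambda>t. \<rho> (y + t *\<^sub>R axis i 1)) has_vector_derivative pdir i \<rho> y) (at 0)"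
    and partials_bound: "\<And>y i. y \<in> ball p r \<Longrightarrow> norm (pdir i \<rho> y) \<le> L"
    and inward: "\<And>y. y \<in> ball p r \<Longrightarrow> \<sigma> * pdir k \<rho> y \<le> - c"
begin

definition inward_dir :: "real^'n" where
  "inward_dir = \<sigma> *\<^sub>R axis k 1"

text \<open>Pushing \<open>x\<close> and \<open>y\<close> inward by \<open>shift_ratio * dist x y\<close> lowers \<open>\<rho>\<close> by more than
  \<open>\<rho>\<close> can grow across the coordinate box spanned by the two pushed points.\<close>

definition shift_ratio :: real where
  "shift_ratio = CARD('n) * L / c + 1"

definition lip_radius :: real where
  "lip_radius = r / (3 + 2 * shift_ratio)"

lemma norm_inward_dir: "norm inward_dir = 1"
  using sign by (simp add: inward_dir_def)

lemma L_nonneg: "L \<ge> 0"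
proof -
  have "norm (pdir k \<rho> p) \<le> L"
    using partials_bound r_pos by simp
  then show ?thesis
    using norm_ge_zero order_trans by blast
qed

lemma shift_ratio_bounds: "shift_ratio \<ge> 1" "c * shift_ratio = CARD('n) * L + c"
  using L_nonneg c_pos by (simp_all add: shift_ratio_def distrib_left)

lemma lip_radius_bounds: "lip_radius > 0" "r = 3 * lip_radius + 2 * (shift_ratio * lip_radius)"
proof -
  have "3 + 2 * shift_ratio > 0"
    using shift_ratio_bounds(1) by simp
  then show "lip_radius > 0"
    using r_pos by (simp add: lip_radius_def)
  have "r = lip_radius * (3 + 2 * shift_ratio)"
    using \<open>3 + 2 * shift_ratio > 0\<close> by (simp add: lip_radius_def)
  then show "r = 3 * lip_radius + 2 * (shift_ratio * lip_radius)"
    by (simp add: algebra_simps)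
qed

lemma ball_lip_radius_subset: "ball p lip_radius \<subseteq> ball p r"
proof -
  have "shift_ratio * lip_radius \<ge> 0"
    using shift_ratio_bounds(1) lip_radius_bounds(1) by simp
  then show ?thesis
    using lip_radius_bounds by (intro subset_ball) linarith
qed

lemma in_chart: "y \<in> ball p r \<Longrightarrow> y \<in> \<Omega> \<longleftrightarrow> \<rho> y < 0"
  using chart by blast

lemma has_vector_derivative_inward:
  fixes f :: "real^'n \<Rightarrow> 'b::real_normed_vector"
  assumes "((\<lambda>t. f (y + t *\<^sub>R axis k 1)) has_vector_derivative d) (at 0)"
  shows "((\<lambda>t. f (y + t *\<^sub>R inward_dir)) has_vector_derivative \<sigma> *\<^sub>R d) (at 0)"
  unfolding inward_dir_def by (rule has_vector_derivative_line_scale[OF assms])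

lemma rho_decreases_inward:
  assumes "0 \<le> t" and path: "\<And>\<tau>. 0 \<le> \<tau> \<Longrightarrow> \<tau> \<le> t \<Longrightarrow> q + \<tau> *\<^sub>R inward_dir \<in> ball p r"
  shows "\<rho> (q + t *\<^sub>R inward_dir) \<le> \<rho> q - c * t"
proof -
  have "\<rho> (q + t *\<^sub>R inward_dir) + c * t \<le> \<rho> (q + 0 *\<^sub>R inward_dir) + c * 0"
  proof (rule DERIV_nonpos_imp_nonincreasing[OF assms(1)])
    fix \<tau>
    assume \<tau>: "0 \<le> \<tau>" "\<tau> \<le> t"
    let ?y = "q + \<tau> *\<^sub>R inward_dir"
    have "((\<lambda>s. \<rho> (?y + s *\<^sub>R inward_dir)) has_vector_derivative \<sigma> *\<^sub>R pdir k \<rho> ?y) (at 0)"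
      by (rule has_vector_derivative_inward[OF partials[OF path[OF \<tau>]]])
    then have "((\<lambda>s. \<rho> (q + s *\<^sub>R inward_dir)) has_vector_derivative \<sigma> *\<^sub>R pdir k \<rho> ?y) (at \<tau>)"
      by (rule has_vector_derivative_line_shift)
    then have "((\<lambda>s. \<rho> (q + s *\<^sub>R inward_dir)) has_real_derivative \<sigma> * pdir k \<rho> ?y) (at \<tau>)"
      by (simp add: has_real_derivative_iff_has_vector_derivative)
    then have "((\<lambda>s. \<rho> (q + s *\<^sub>R inward_dir) + c * s) has_real_derivative \<sigma> * pdir k \<rho> ?y + c) (at \<tau>)"
      by (auto intro!: derivative_eq_intros)
    moreover have "\<sigma> * pdir k \<rho> ?y + c \<le> 0"
      using inward[OF path[OF \<tau>]] by simp
    ultimately show "\<exists>D. ((\<lambda>s. \<rho> (q + s *\<^sub>R inward_dir) + c * s) has_real_derivative D) (at \<tau>) \<and> D \<le> 0"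
      by blast
  qed
  then show ?thesis by simp
qed

lemma shift_inward:
  assumes q: "q \<in> \<Omega> \<inter> ball p lip_radius" and t: "0 \<le> t" "t < 2 * shift_ratio * lip_radius"
  shows "q + t *\<^sub>R inward_dir \<in> \<Omega>" "\<rho> (q + t *\<^sub>R inward_dir) \<le> \<rho> q - c * t"
    and "dist p (q + t *\<^sub>R inward_dir) < lip_radius + t"
proof -
  have dist_path: "dist p (q + \<tau> *\<^sub>R inward_dir) < lip_radius + \<tau>" if "0 \<le> \<tau>" for \<tau>
  proof -
    have "dist p (q + \<tau> *\<^sub>R inward_dir) \<le> dist p q + dist q (q + \<tau> *\<^sub>R inward_dir)"
      by (rule dist_triangle)
    also have "dist q (q + \<tau> *\<^sub>R inward_dir) = \<tau>"
      using that by (simp add: dist_norm norm_inward_dir)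
    finally show ?thesis
      using q by simp
  qed
  have path: "q + \<tau> *\<^sub>R inward_dir \<in> ball p r" if "0 \<le> \<tau>" "\<tau> \<le> t" for \<tau>
    using dist_path[OF that(1)] that(2) t(2) lip_radius_bounds by simp
  show descent: "\<rho> (q + t *\<^sub>R inward_dir) \<le> \<rho> q - c * t"
    by (rule rho_decreases_inward[OF t(1) path])
  have "\<rho> q < 0"
    using q path[of 0] t(1) in_chart by auto
  moreover have "c * t \<ge> 0"
    using c_pos t(1) by simp
  ultimately show "q + t *\<^sub>R inward_dir \<in> \<Omega>"
    using in_chart[OF path[OF t(1) order_refl]] descent by linarith
  show "dist p (q + t *\<^sub>R inward_dir) < lip_radius + t"
    by (rule dist_path[OF t(1)])
qed

lemma shifted_box_subset:
  assumes x: "x \<in> \<Omega> \<inter> ball p lip_radius" and y: "y \<in> \<Omega> \<inter> ball p lip_radius"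
  defines "s \<equiv> shift_ratio * dist x y"
  shows "cbox (inf (x + s *\<^sub>R inward_dir) (y + s *\<^sub>R inward_dir))
              (sup (x + s *\<^sub>R inward_dir) (y + s *\<^sub>R inward_dir)) \<subseteq> \<Omega>" (is "?box \<subseteq> \<Omega>")
proof
  let ?x' = "x + s *\<^sub>R inward_dir" and ?y' = "y + s *\<^sub>R inward_dir"
  define d where "d = dist x y"
  have d: "d < 2 * lip_radius"
    using x y dist_triangle[of x y p] by (auto simp: d_def dist_commute)
  have s: "0 \<le> s" "s < 2 * shift_ratio * lip_radius"
    using d shift_ratio_bounds(1) by (auto simp: s_def d_def)
  have x': "\<rho> ?x' \<le> \<rho> x - c * s" "dist p ?x' < lip_radius + s"
    using shift_inward[OF x s] by auto
  have "\<rho> x < 0"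
    using x in_chart ball_lip_radius_subset by blast
  have cs: "c * s = CARD('n) * L * d + c * d"
    unfolding s_def d_def[symmetric] mult.assoc[symmetric] shift_ratio_bounds(2) by (simp add: algebra_simps)
  have near_x': "dist ?x' w \<le> d \<and> dist p w < r" if "w \<in> ?box" for w
  proof -
    have "dist ?x' w \<le> dist ?x' ?y'"
      by (rule dist_le_coord_box[OF that])
    also have "dist ?x' ?y' = d"
      by (simp add: d_def dist_norm)
    finally have "dist ?x' w \<le> d" .
    moreover have "dist p w \<le> dist p ?x' + dist ?x' w"
      by (rule dist_triangle)
    ultimately show ?thesis
      using x'(2) d s lip_radius_bounds(2) by linarith
  qed
  fix w
  assume w: "w \<in> ?box"
  have "cbox (inf ?x' w) (sup ?x' w) \<subseteq> ball p r"
    using coord_box_subset[OF w] near_x' by (auto simp: dist_commute)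
  then have "norm (\<rho> w - \<rho> ?x') \<le> CARD('n) * L * dist ?x' w"
    using norm_diff_le_coord_box[where S="ball p r" and f=\<rho> and M=L, OF partials partials_bound L_nonneg] by blast
  also have "\<dots> \<le> CARD('n) * L * d"
    using near_x'[OF w] L_nonneg by (intro mult_left_mono) auto
  finally have "\<rho> w \<le> \<rho> x - c * d"
    using x'(1) cs by (simp add: abs_le_iff)
  then have "\<rho> w < 0"
    using \<open>\<rho> x < 0\<close> c_pos d_def by (smt (verit) mult_nonneg_nonneg zero_le_dist)
  then show "w \<in> \<Omega>"
    using in_chart near_x'[OF w] by (auto simp: dist_commute)
qed

lemma lipschitz_near_boundary_point:
  fixes f :: "real^'n \<Rightarrow> 'b::real_normed_vector" and M :: real
  assumes deriv: "\<And>w i. w \<in> \<Omega> \<Longrightarrow> ((\<lambda>t. f (w + t *\<^sub>R axis i 1)) has_vector_derivative pdir i f w) (at 0)"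
    and bound: "\<And>w i. w \<in> \<Omega> \<Longrightarrow> norm (pdir i f w) \<le> M" and "M \<ge> 0"
    and x: "x \<in> \<Omega> \<inter> ball p lip_radius" and y: "y \<in> \<Omega> \<inter> ball p lip_radius"
  shows "norm (f x - f y) \<le> (2 * shift_ratio + CARD('n)) * M * dist x y"
proof -
  define s where "s = shift_ratio * dist x y"
  let ?x' = "x + s *\<^sub>R inward_dir" and ?y' = "y + s *\<^sub>R inward_dir"
  have s: "0 \<le> s" "s < 2 * shift_ratio * lip_radius"
    using x y dist_triangle[of x y p] shift_ratio_bounds(1) by (auto simp: s_def dist_commute)
  have along: "norm (f (q + s *\<^sub>R inward_dir) - f q) \<le> M * s" if q: "q \<in> \<Omega> \<inter> ball p lip_radius" for q
  proof -
    have "norm (f (q + s *\<^sub>R inward_dir) - f q) \<le> M * \<bar>s\<bar>"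
    proof (rule norm_diff_le_along_line[where S=\<Omega> and f'="\<lambda>w. \<sigma> *\<^sub>R pdir k f w"])
      fix t
      assume "t \<in> closed_segment 0 s"
      then show "q + t *\<^sub>R inward_dir \<in> \<Omega>"
        using shift_inward(1)[OF q] s by (auto simp: closed_segment_eq_real_ivl)
    qed (use has_vector_derivative_inward[OF deriv] bound sign in auto)
    then show ?thesis
      using s by simp
  qed
  have "norm (f ?y' - f ?x') \<le> CARD('n) * M * dist ?x' ?y'"
    by (rule norm_diff_le_coord_box[OF deriv bound \<open>M \<ge> 0\<close> shifted_box_subset[OF x y, folded s_def]])
  also have "dist ?x' ?y' = dist x y"
    by (simp add: dist_norm)
  finally have middle: "norm (f ?y' - f ?x') \<le> CARD('n) * M * dist x y" .
  have "norm (f x - f y) \<le> norm ((f ?y' - f y) - (f ?x' - f x)) + norm (f ?y' - f ?x')"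
    using norm_triangle_ineq4[of "(f ?y' - f y) - (f ?x' - f x)" "f ?y' - f ?x'"] by (simp add: algebra_simps)
  also have "\<dots> \<le> norm (f ?y' - f y) + norm (f ?x' - f x) + norm (f ?y' - f ?x')"
    using norm_triangle_ineq4 by simp
  also have "\<dots> \<le> M * s + M * s + CARD('n) * M * dist x y"
    using along[OF x] along[OF y] middle by simp
  finally show ?thesis
    by (simp add: s_def algebra_simps)
qed

end

lemma compact_bounded_family:
  fixes g :: "'i::finite \<Rightarrow> 'a::topological_space \<Rightarrow> 'b::real_normed_vector"
  assumes "compact K" "\<And>i. continuous_on K (g i)"
  obtains L where "\<And>i y. y \<in> K \<Longrightarrow> norm (g i y) \<le> L"
proof -
  have "bounded (g i ` K)" for i
    using compact_continuous_image[OF assms(2) assms(1)] by (rule compact_imp_bounded)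
  then have "bounded (\<Union>i. g i ` K)"
    by (intro bounded_UN) auto
  then show ?thesis
    using that unfolding bounded_iff by blast
qed

lemma neg_sgn_mult_le:
  fixes a b :: real
  assumes "dist b a < \<bar>a\<bar> / 2"
  shows "- sgn a * b \<le> - (\<bar>a\<bar> / 2)"
  using assms by (auto simp: dist_real_def sgn_if abs_if split: if_splits)

lemma C2_boundary_chart:
  fixes \<Omega> :: "(real^'n::finite) set"
  assumes "C2_boundary \<Omega>" "p \<in> frontier \<Omega>"
  obtains \<rho> r k \<sigma> c L where "boundary_chart \<Omega> \<rho> p r k \<sigma> c L"
proof -
  obtain R and \<rho> :: "real^'n \<Rightarrow> real" where R: "R > 0" "Ck_on 2 (ball p R) \<rho>" "\<forall>y\<in>ball p R. \<exists>i. pdir i \<rho> y \<noteq> 0"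
    "\<Omega> \<inter> ball p R = {y \<in> ball p R. \<rho> y < 0}"
    using assms unfolding C2_boundary_def by blast
  have partials: "((\<lambda>t. \<rho> (y + t *\<^sub>R axis i 1)) has_vector_derivative pdir i \<rho> y) (at 0)"
    if "y \<in> ball p R" for y i
    using R(2)[unfolded Ck_on_def has_pderivs_upto_def, THEN conjunct1, rule_format, of "[]" y i] that
    by simp
  have continuous: "continuous_on (ball p R) (pdir i \<rho>)" for i
    using R(2)[unfolded Ck_on_def, THEN conjunct2, rule_format, of "[i]"] by simp
  obtain k where k: "pdir k \<rho> p \<noteq> 0"
    using R(1,3) by fastforce
  define a where "a = pdir k \<rho> p"
  define c where "c = \<bar>a\<bar> / 2"
  have "c > 0"
    using k by (simp add: c_def a_def)
  have "isCont (pdir k \<rho>) p"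
    using continuous[of k] R(1) by (simp add: continuous_on_eq_continuous_at)
  then obtain r' where r': "r' > 0" "\<And>y. dist y p < r' \<Longrightarrow> dist (pdir k \<rho> y) a < c"
    using \<open>c > 0\<close> unfolding continuous_at_eps_delta a_def by blast
  define r where "r = min r' (R / 2)"
  have r: "r > 0" "cball p r \<subseteq> ball p R"
    using r' R(1) by (auto simp: r_def)
  obtain L where L: "\<And>i y. y \<in> cball p r \<Longrightarrow> norm (pdir i \<rho> y) \<le> L"
    by (rule compact_bounded_family[of "cball p r" "\<lambda>i. pdir i \<rho>"])
      (auto intro: continuous_on_subset[OF continuous r(2)])
  have sub: "ball p r \<subseteq> ball p R"
    using r(2) ball_subset_cball by blast
  show ?thesis
  proof (rule that[of \<rho> r k "- sgn a" c L], unfold_locales)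
    show "\<Omega> \<inter> ball p r = {y \<in> ball p r. \<rho> y < 0}"
      using R(4) sub by blast
    fix y
    assume y: "y \<in> ball p r"
    then show "((\<lambda>t. \<rho> (y + t *\<^sub>R axis i 1)) has_vector_derivative pdir i \<rho> y) (at 0)"
      and "norm (pdir i \<rho> y) \<le> L" for i
      using partials[of y i] L[of y i] sub by auto
    have "dist (pdir k \<rho> y) a < \<bar>a\<bar> / 2"
      using r' y by (auto simp: r_def c_def dist_commute)
    then show "- sgn a * pdir k \<rho> y \<le> - c"
      unfolding c_def by (rule neg_sgn_mult_le)
  next
    show "\<bar>- sgn a\<bar> = 1"
      using k by (simp add: a_def sgn_if)
  qed (use r \<open>c > 0\<close> in auto)
qed

lemma C2_boundary_local_lipschitz:
  fixes f :: "real^'n::finite \<Rightarrow> 'b::real_normed_vector" and M :: real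
  assumes "open \<Omega>" "C2_boundary \<Omega>" "p \<in> closure \<Omega>"
    and deriv: "\<And>w i. w \<in> \<Omega> \<Longrightarrow> ((\<lambda>t. f (w + t *\<^sub>R axis i 1)) has_vector_derivative pdir i f w) (at 0)"
    and bound: "\<And>w i. w \<in> \<Omega> \<Longrightarrow> norm (pdir i f w) \<le> M" "M \<ge> 0"
  shows "\<exists>r>0. \<exists>A. \<forall>x\<in>\<Omega> \<inter> ball p r. \<forall>y\<in>\<Omega> \<inter> ball p r. norm (f x - f y) \<le> A * dist x y"
proof (cases "p \<in> \<Omega>")
  case True
  then obtain r where r: "r > 0" "ball p r \<subseteq> \<Omega>"
    using assms(1) open_contains_ball by blast
  then have "\<forall>x\<in>\<Omega> \<inter> ball p (r / 3). \<forall>y\<in>\<Omega> \<inter> ball p (r / 3). norm (f x - f y) \<le> CARD('n) * M * dist x y"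
    using lipschitz_near_interior_point[OF r(2) deriv bound] by auto
  moreover have "r / 3 > 0"
    using r(1) by simp
  ultimately show ?thesis
    by blast
next
  case False
  then have "p \<in> frontier \<Omega>"
    using assms(1,3) by (simp add: frontier_def interior_open)
  then obtain \<rho> r k \<sigma> c L where "boundary_chart \<Omega> \<rho> p r k \<sigma> c L"
    using C2_boundary_chart assms(2) by blast
  then interpret boundary_chart \<Omega> \<rho> p r k \<sigma> c L .
  have "\<forall>x\<in>\<Omega> \<inter> ball p lip_radius. \<forall>y\<in>\<Omega> \<inter> ball p lip_radius.
      norm (f x - f y) \<le> (2 * shift_ratio + CARD('n)) * M * dist x y"
    using lipschitz_near_boundary_point[OF deriv bound] by simp
  then show ?thesis
    using lip_radius_bounds(1) by blast
qed

lemma C2_boundary_bdd_holder_quots: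
  fixes f :: "real^'n::finite \<Rightarrow> 'b::euclidean_space"
  assumes "open \<Omega>" "bounded \<Omega>" "C2_boundary \<Omega>" "0 \<le> \<alpha>" "\<alpha> \<le> 1"
    and "has_pderivs_upto \<Omega> 1 f" "uniformly_continuous_on \<Omega> f" "\<And>i. uniformly_continuous_on \<Omega> (pdir i f)"
  shows "bdd_above (holder_quots \<Omega> \<alpha> f)"
proof -
  have deriv: "\<And>w i. w \<in> \<Omega> \<Longrightarrow> ((\<lambda>t. f (w + t *\<^sub>R axis i 1)) has_vector_derivative pdir i f w) (at 0)"
    using assms(6)[unfolded has_pderivs_upto_def, rule_format, of "[]"] by simp
  have "bounded (\<Union>i. pdir i f ` \<Omega>)"
    using bounded_uniformly_continuous_image[OF assms(8) assms(2)] by (intro bounded_UN) auto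
  then obtain M where M: "M > 0" "\<And>w i. w \<in> \<Omega> \<Longrightarrow> norm (pdir i f w) \<le> M"
    unfolding bounded_pos by blast
  obtain B where B: "\<And>x. x \<in> \<Omega> \<Longrightarrow> norm (f x) \<le> B"
    using bounded_uniformly_continuous_image[OF assms(7,2)] unfolding bounded_iff by blast
  obtain e A where "e > 0"
    and "\<And>x y. x \<in> \<Omega> \<Longrightarrow> y \<in> \<Omega> \<Longrightarrow> dist x y < e \<Longrightarrow> norm (f x - f y) \<le> A * dist x y"
    using uniform_lipschitz_radius[OF assms(2)
        C2_boundary_local_lipschitz[OF assms(1,3) _ deriv M(2) less_imp_le[OF M(1)]]]
    by blast
  then show ?thesis
    by (intro bdd_above_holder_quots_small_scale_lipschitz[OF \<open>e > 0\<close> assms(4,5) B])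
qed

section \<open>Calculus in Hoelder classes\<close>

lemma abs_inverse_diff_le:
  fixes a b m :: real
  assumes "m > 0" "m \<le> a" "m \<le> b"
  shows "\<bar>inverse a - inverse b\<bar> \<le> \<bar>a - b\<bar> / m\<^sup>2"
proof -
  have "inverse a - inverse b = (b - a) / (a * b)"
    using assms by (simp add: field_simps)
  also have "\<bar>\<dots>\<bar> = \<bar>a - b\<bar> / (a * b)"
    using assms by simp
  also have "\<dots> \<le> \<bar>a - b\<bar> / m\<^sup>2"
    using assms by (intro divide_left_mono) (auto simp: power2_eq_square intro: mult_mono)
  finally show ?thesis .
qed

lemma abs_sqrt_diff_le:
  fixes a b m :: real
  assumes "m > 0" "m \<le> a" "m \<le> b"
  shows "\<bar>sqrt a - sqrt b\<bar> \<le> \<bar>a - b\<bar> / (2 * sqrt m)"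
proof -
  have "a - b = (sqrt a - sqrt b) * (sqrt a + sqrt b)"
    using assms by (simp add: algebra_simps)
  then have "\<bar>a - b\<bar> = \<bar>sqrt a - sqrt b\<bar> * (sqrt a + sqrt b)"
    using assms by (simp add: abs_mult)
  moreover have "2 * sqrt m \<le> sqrt a + sqrt b"
    using real_sqrt_le_mono[OF assms(2)] real_sqrt_le_mono[OF assms(3)] by linarith
  ultimately have "\<bar>sqrt a - sqrt b\<bar> * (2 * sqrt m) \<le> \<bar>a - b\<bar>"
    by (metis abs_ge_zero mult_left_mono)
  then show ?thesis
    using assms by (simp add: field_simps)
qed

locale holder_domain =
  fixes \<Omega> :: "(real^'n::finite) set" and \<alpha> :: real
  assumes open_domain: "open \<Omega>" and bounded_domain: "bounded \<Omega>" and C2_domain: "C2_boundary \<Omega>"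
    and alpha: "0 \<le> \<alpha>" "\<alpha> \<le> 1"
begin

lemma holder_on_Suc_imp:
  fixes f :: "real^'n \<Rightarrow> 'b::euclidean_space"
  shows "holder_on \<Omega> \<alpha> (Suc k) f \<Longrightarrow> holder_on \<Omega> \<alpha> k f"
proof (induction k arbitrary: f)
  case 0
  then have "has_pderivs_upto \<Omega> 1 f" "uniformly_continuous_on \<Omega> f"
    and "\<And>i. uniformly_continuous_on \<Omega> (pdir i f)"
    unfolding holder_on_Suc_iff holder_on_0_iff by auto
  then have "bdd_above (holder_quots \<Omega> \<alpha> f)"
    by (rule C2_boundary_bdd_holder_quots[OF open_domain bounded_domain C2_domain alpha])
  then show ?case
    using \<open>uniformly_continuous_on \<Omega> f\<close> by (simp add: holder_on_0_iff)
next
  case (Suc k)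
  then show ?case
    unfolding holder_on_Suc_iff[of \<Omega> \<alpha> "Suc k"] holder_on_Suc_iff[of \<Omega> \<alpha> k] by blast
qed

lemma holder_on_mono:
  fixes f :: "real^'n \<Rightarrow> 'b::euclidean_space"
  shows "m \<le> k \<Longrightarrow> holder_on \<Omega> \<alpha> k f \<Longrightarrow> holder_on \<Omega> \<alpha> m f"
  by (induction k rule: dec_induct) (auto intro: holder_on_Suc_imp)

lemma holder_on_bounded:
  fixes f :: "real^'n \<Rightarrow> 'b::euclidean_space"
  assumes "holder_on \<Omega> \<alpha> k f"
  obtains B where "B \<ge> 0" "\<And>x. x \<in> \<Omega> \<Longrightarrow> norm (f x) \<le> B"
proof -
  have "bounded (f ` \<Omega>)"
    using holder_on_uniformly_continuous[OF assms] bounded_domain by (rule bounded_uniformly_continuous_image)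
  then show ?thesis
    using that unfolding bounded_pos by (auto intro: less_imp_le)
qed

lemma holder_on_add:
  fixes f g :: "real^'n \<Rightarrow> 'b::euclidean_space"
  shows "holder_on \<Omega> \<alpha> k f \<Longrightarrow> holder_on \<Omega> \<alpha> k g \<Longrightarrow> holder_on \<Omega> \<alpha> k (\<lambda>x. f x + g x)"
proof (induction k arbitrary: f g)
  have base: "holder_on \<Omega> \<alpha> 0 (\<lambda>x. f x + g x)" if "holder_on \<Omega> \<alpha> 0 f" "holder_on \<Omega> \<alpha> 0 g"
    for f g :: "real^'n \<Rightarrow> 'b"
    by (rule holder_on_0_dominated[OF that, of 1 1]) (auto intro: norm_diff_triangle_ineq)
  {
    case 0
    then show ?case by (rule base)
  next
    case (Suc k)
    show ?case
    proof (rule holder_on_SucI[OF open_domain, where f'="\<lambda>i x. pdir i f x + pdir i g x"])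
      show "((\<lambda>t. f (x + t *\<^sub>R axis i 1) + g (x + t *\<^sub>R axis i 1)) has_vector_derivative
          pdir i f x + pdir i g x) (at 0)" if "x \<in> \<Omega>" for i x
        using holder_on_SucD[OF Suc.prems(1) that] holder_on_SucD[OF Suc.prems(2) that]
        by (rule has_vector_derivative_add)
      show "uniformly_continuous_on \<Omega> (\<lambda>x. f x + g x)"
        using base[OF holder_on_mono[OF _ Suc.prems(1)] holder_on_mono[OF _ Suc.prems(2)]]
        by (simp add: holder_on_0_iff)
      show "holder_on \<Omega> \<alpha> k (\<lambda>x. pdir i f x + pdir i g x)" for i
        using Suc.IH Suc.prems unfolding holder_on_Suc_iff by blast
    qed
  }
qed

lemma holder_on_bounded_linear:
  fixes f :: "real^'n \<Rightarrow> 'b::euclidean_space" and L :: "'b \<Rightarrow> 'c::euclidean_space"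
  assumes L: "bounded_linear L"
  shows "holder_on \<Omega> \<alpha> k f \<Longrightarrow> holder_on \<Omega> \<alpha> k (\<lambda>x. L (f x))"
proof (induction k arbitrary: f)
  obtain K where K: "K > 0" "\<And>x. norm (L x) \<le> norm x * K"
    using bounded_linear.pos_bounded[OF L] by blast
  have base: "holder_on \<Omega> \<alpha> 0 (\<lambda>x. L (f x))" if "holder_on \<Omega> \<alpha> 0 f" for f
  proof (rule holder_on_0_lipschitz_comp[OF that])
    show "norm (L (f x) - L (f y)) \<le> K * norm (f x - f y)" for x y
      using K(2)[of "f x - f y"] by (simp add: linear_diff[OF bounded_linear.linear[OF L]] mult.commute)
  qed (use K in auto)
  {
    case 0
    then show ?case by (rule base)
  next
    case (Suc k)
    show ?case
    proof (rule holder_on_SucI[OF open_domain, where f'="\<lambda>i x. L (pdir i f x)"])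
      show "((\<lambda>t. L (f (x + t *\<^sub>R axis i 1))) has_vector_derivative L (pdir i f x)) (at 0)"
        if "x \<in> \<Omega>" for i x
        by (rule bounded_linear.has_vector_derivative[OF L holder_on_SucD[OF Suc.prems that]])
      show "uniformly_continuous_on \<Omega> (\<lambda>x. L (f x))"
        using base[OF holder_on_mono[OF _ Suc.prems]] by (simp add: holder_on_0_iff)
      show "holder_on \<Omega> \<alpha> k (\<lambda>x. L (pdir i f x))" for i
        using Suc.IH Suc.prems unfolding holder_on_Suc_iff by blast
    qed
  }
qed

lemma holder_on_0_mult:
  fixes f g :: "real^'n \<Rightarrow> real"
  assumes f: "holder_on \<Omega> \<alpha> 0 f" and g: "holder_on \<Omega> \<alpha> 0 g"
  shows "holder_on \<Omega> \<alpha> 0 (\<lambda>x. f x * g x)"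
proof -
  obtain Bf where Bf: "Bf \<ge> 0" "\<And>x. x \<in> \<Omega> \<Longrightarrow> norm (f x) \<le> Bf"
    using holder_on_bounded[OF f] by blast
  obtain Bg where Bg: "Bg \<ge> 0" "\<And>x. x \<in> \<Omega> \<Longrightarrow> norm (g x) \<le> Bg"
    using holder_on_bounded[OF g] by blast
  show ?thesis
  proof (rule holder_on_0_dominated[OF f g Bg(1) Bf(1)])
    fix x y
    assume "x \<in> \<Omega>" "y \<in> \<Omega>"
    have "f x * g x - f y * g y = (f x - f y) * g x + f y * (g x - g y)"
      by (simp add: algebra_simps)
    also have "\<bar>\<dots>\<bar> \<le> \<bar>f x - f y\<bar> * Bg + Bf * \<bar>g x - g y\<bar>"
      using Bf(2)[OF \<open>y \<in> \<Omega>\<close>] Bg(2)[OF \<open>x \<in> \<Omega>\<close>]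
      by (auto simp: abs_mult intro!: add_mono mult_mono order_trans[OF abs_triangle_ineq])
    finally show "norm (f x * g x - f y * g y) \<le> Bg * norm (f x - f y) + Bf * norm (g x - g y)"
      by (simp add: mult.commute)
  qed
qed

lemma holder_on_mult:
  fixes f g :: "real^'n \<Rightarrow> real"
  shows "holder_on \<Omega> \<alpha> k f \<Longrightarrow> holder_on \<Omega> \<alpha> k g \<Longrightarrow> holder_on \<Omega> \<alpha> k (\<lambda>x. f x * g x)"
proof (induction k arbitrary: f g)
  case 0
  then show ?case by (rule holder_on_0_mult)
next
  case (Suc k)
  show ?case
  proof (rule holder_on_SucI[OF open_domain, where f'="\<lambda>i x. pdir i f x * g x + pdir i g x * f x"])
    show "((\<lambda>t. f (x + t *\<^sub>R axis i 1) * g (x + t *\<^sub>R axis i 1)) has_vector_derivative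
        pdir i f x * g x + pdir i g x * f x) (at 0)" if "x \<in> \<Omega>" for i x
      using DERIV_mult[OF holder_on_SucD_real[OF Suc.prems(1) that] holder_on_SucD_real[OF Suc.prems(2) that]]
      by (simp add: has_real_derivative_iff_has_vector_derivative)
    show "uniformly_continuous_on \<Omega> (\<lambda>x. f x * g x)"
      using holder_on_0_mult[OF holder_on_mono[OF _ Suc.prems(1)] holder_on_mono[OF _ Suc.prems(2)]]
      by (simp add: holder_on_0_iff)
    fix i
    have "holder_on \<Omega> \<alpha> k f" "holder_on \<Omega> \<alpha> k g"
      using Suc.prems holder_on_Suc_imp by auto
    moreover have "holder_on \<Omega> \<alpha> k (pdir i f)" "holder_on \<Omega> \<alpha> k (pdir i g)"
      using Suc.prems unfolding holder_on_Suc_iff by auto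
    ultimately show "holder_on \<Omega> \<alpha> k (\<lambda>x. pdir i f x * g x + pdir i g x * f x)"
      by (intro holder_on_add Suc.IH)
  qed
qed

lemma holder_on_inverse:
  fixes h :: "real^'n \<Rightarrow> real"
  assumes "m > 0"
  shows "holder_on \<Omega> \<alpha> k h \<Longrightarrow> (\<And>x. x \<in> \<Omega> \<Longrightarrow> m \<le> h x) \<Longrightarrow> holder_on \<Omega> \<alpha> k (\<lambda>x. inverse (h x))"
proof (induction k arbitrary: h)
  have base: "holder_on \<Omega> \<alpha> 0 (\<lambda>x. inverse (h x))"
    if h: "holder_on \<Omega> \<alpha> 0 h" and lower: "\<And>x. x \<in> \<Omega> \<Longrightarrow> m \<le> h x" for h
    by (rule holder_on_0_lipschitz_comp[OF h, of "1 / m\<^sup>2"])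
      (use abs_inverse_diff_le[OF \<open>m > 0\<close>] lower in auto)
  {
    case 0
    then show ?case by (intro base)
  next
    case (Suc k)
    show ?case
    proof (rule holder_on_SucI[OF open_domain, where f'="\<lambda>i x. - (pdir i h x * (inverse (h x) * inverse (h x)))"])
      show "((\<lambda>t. inverse (h (x + t *\<^sub>R axis i 1))) has_vector_derivative
          - (pdir i h x * (inverse (h x) * inverse (h x)))) (at 0)" if "x \<in> \<Omega>" for i x
      proof -
        have "h x \<noteq> 0"
          using Suc.prems(2)[OF that] \<open>m > 0\<close> by linarith
        then show ?thesis
          using DERIV_inverse_fun[OF holder_on_SucD_real[OF Suc.prems(1) that]]
          by (simp add: has_real_derivative_iff_has_vector_derivative power2_eq_square)
      qed
      show "uniformly_continuous_on \<Omega> (\<lambda>x. inverse (h x))"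
        using base[OF holder_on_mono[OF _ Suc.prems(1)] Suc.prems(2)] by (simp add: holder_on_0_iff)
      fix i
      have "holder_on \<Omega> \<alpha> k (\<lambda>x. inverse (h x))"
        using Suc.IH[OF holder_on_Suc_imp[OF Suc.prems(1)] Suc.prems(2)] .
      moreover have "holder_on \<Omega> \<alpha> k (pdir i h)"
        using Suc.prems(1) unfolding holder_on_Suc_iff by auto
      ultimately have "holder_on \<Omega> \<alpha> k (\<lambda>x. pdir i h x * (inverse (h x) * inverse (h x)))"
        by (intro holder_on_mult)
      then show "holder_on \<Omega> \<alpha> k (\<lambda>x. - (pdir i h x * (inverse (h x) * inverse (h x))))"
        by (rule holder_on_bounded_linear[OF bounded_linear_minus[OF bounded_linear_ident]])
    qed
  }
qed

lemma holder_on_sqrt: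
  fixes g :: "real^'n \<Rightarrow> real"
  assumes "m > 0"
  shows "holder_on \<Omega> \<alpha> k g \<Longrightarrow> (\<And>x. x \<in> \<Omega> \<Longrightarrow> m \<le> g x) \<Longrightarrow> holder_on \<Omega> \<alpha> k (\<lambda>x. sqrt (g x))"
proof (induction k arbitrary: g)
  have base: "holder_on \<Omega> \<alpha> 0 (\<lambda>x. sqrt (g x))"
    if g: "holder_on \<Omega> \<alpha> 0 g" and lower: "\<And>x. x \<in> \<Omega> \<Longrightarrow> m \<le> g x" for g
    by (rule holder_on_0_lipschitz_comp[OF g, of "1 / (2 * sqrt m)"])
      (use abs_sqrt_diff_le[OF \<open>m > 0\<close>] lower \<open>m > 0\<close> in auto)
  {
    case 0
    then show ?case by (intro base)
  next
    case (Suc k)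
    show ?case
    proof (rule holder_on_SucI[OF open_domain, where f'="\<lambda>i x. inverse (sqrt (g x)) / 2 * pdir i g x"])
      show "((\<lambda>t. sqrt (g (x + t *\<^sub>R axis i 1))) has_vector_derivative
          inverse (sqrt (g x)) / 2 * pdir i g x) (at 0)" if "x \<in> \<Omega>" for i x
      proof -
        have "g x > 0"
          using Suc.prems(2)[OF that] \<open>m > 0\<close> by linarith
        then have "(sqrt has_real_derivative inverse (sqrt (g x)) / 2) (at (g (x + 0 *\<^sub>R axis i 1)))"
          using DERIV_real_sqrt by simp
        from DERIV_chain2[OF this holder_on_SucD_real[OF Suc.prems(1) that]] show ?thesis
          by (simp add: has_real_derivative_iff_has_vector_derivative)
      qed
      show "uniformly_continuous_on \<Omega> (\<lambda>x. sqrt (g x))"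
        using base[OF holder_on_mono[OF _ Suc.prems(1)] Suc.prems(2)] by (simp add: holder_on_0_iff)
      fix i
      have sqrt_g: "holder_on \<Omega> \<alpha> k (\<lambda>x. sqrt (g x))"
        using Suc.IH[OF holder_on_Suc_imp[OF Suc.prems(1)] Suc.prems(2)] .
      have "holder_on \<Omega> \<alpha> k (\<lambda>x. inverse (sqrt (g x)))"
        by (rule holder_on_inverse[of "sqrt m", OF _ sqrt_g]) (use \<open>m > 0\<close> Suc.prems(2) in auto)
      then have "holder_on \<Omega> \<alpha> k (\<lambda>x. inverse (sqrt (g x)) / 2)"
        by (rule holder_on_bounded_linear[OF bounded_linear_divide])
      moreover have "holder_on \<Omega> \<alpha> k (pdir i g)"
        using Suc.prems(1) unfolding holder_on_Suc_iff by auto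
      ultimately show "holder_on \<Omega> \<alpha> k (\<lambda>x. inverse (sqrt (g x)) / 2 * pdir i g x)"
        by (rule holder_on_mult)
    qed
  }
qed

lemma bounded_pdiff_image:
  fixes f :: "real^'n \<Rightarrow> 'b::euclidean_space"
  shows "holder_on \<Omega> \<alpha> k f \<Longrightarrow> length \<beta> \<le> k \<Longrightarrow> bounded (pdiff \<beta> f ` \<Omega>)"
  unfolding holder_on_def using bounded_uniformly_continuous_image bounded_domain by blast

lemma supnorm_add_holder_seminorm_le:
  fixes f :: "real^'n \<Rightarrow> 'b::euclidean_space"
  assumes "holder_on \<Omega> \<alpha> k f" "\<Omega> \<noteq> {}"
  shows "supnorm \<Omega> f + holder_seminorm \<Omega> k \<alpha> f \<le> holder_norm \<Omega> k \<alpha> f"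
proof -
  have "supnorm \<Omega> (pdiff \<beta> f) \<ge> 0" if "length \<beta> \<le> k" for \<beta>
    using supnorm_nonneg[OF bounded_pdiff_image[OF assms(1) that]] assms(2) by blast
  then have "(\<Sum>\<beta> | length \<beta> = m. supnorm \<Omega> (pdiff \<beta> f)) \<ge> 0" if "m \<le> k" for m
    using that by (intro sum_nonneg) auto
  then have "(\<Sum>\<beta> | length \<beta> = 0. supnorm \<Omega> (pdiff \<beta> f)) \<le> (\<Sum>m\<le>k. \<Sum>\<beta> | length \<beta> = m. supnorm \<Omega> (pdiff \<beta> f))"
    by (intro member_le_sum) auto
  moreover have "{\<beta>::'n list. length \<beta> = 0} = {[]}"
    by auto
  ultimately show ?thesis
    unfolding holder_norm_def by simp
qed

lemma holder_seminorm_nonneg: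
  assumes "holder_on \<Omega> \<alpha> k f" "\<Omega> \<noteq> {}"
  shows "holder_seminorm \<Omega> k \<alpha> f \<ge> 0"
  unfolding holder_seminorm_def
proof (rule sum_nonneg)
  fix \<beta> :: "'n list"
  assume "\<beta> \<in> {\<beta>. length \<beta> = k}"
  then have "bdd_above (holder_quots \<Omega> \<alpha> (pdiff \<beta> f))"
    using assms(1) unfolding holder_on_def by auto
  then show "holder_semi \<Omega> \<alpha> (pdiff \<beta> f) \<ge> 0"
    by (rule holder_semi_nonneg[OF _ holder_quots_nonempty[OF open_domain assms(2)]])
qed

lemma norm_le_supnorm_closure:
  fixes f :: "real^'n \<Rightarrow> 'b::euclidean_space"
  assumes "holder_space \<Omega> k \<alpha> f" "x \<in> closure \<Omega>"
  shows "norm (f x) \<le> supnorm \<Omega> f"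
proof -
  have "bounded (f ` \<Omega>)"
    using bounded_pdiff_image[of k f "[]"] assms(1) by (simp add: holder_space_iff)
  then have "\<forall>y\<in>\<Omega>. norm (f y) \<le> supnorm \<Omega> f"
    using supnorm_upper by blast
  moreover have "continuous_on (closure \<Omega>) f"
    using assms(1) by (simp add: holder_space_iff)
  ultimately show ?thesis
    using continuous_on_closure_norm_le assms(2) by blast
qed

end

section \<open>The decomposition\<close>

lemma bounded_linear_family_bound:
  assumes "finite I" "\<And>i. i \<in> I \<Longrightarrow> bounded_linear (L i)"
  obtains K where "K > 0" "\<And>i u. i \<in> I \<Longrightarrow> norm (L i u) \<le> K * norm u"
proof
  have nonneg: "\<And>i. i \<in> I \<Longrightarrow> onorm (L i) \<ge> 0"
    using assms(2) onorm_pos_le by blast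
  then have "(\<Sum>i\<in>I. onorm (L i)) \<ge> 0"
    by (rule sum_nonneg)
  then show "1 + (\<Sum>i\<in>I. onorm (L i)) > 0"
    by linarith
  fix i u
  assume "i \<in> I"
  have "norm (L i u) \<le> onorm (L i) * norm u"
    using assms(2)[OF \<open>i \<in> I\<close>] by (rule onorm)
  also have "onorm (L i) \<le> 1 + (\<Sum>i\<in>I. onorm (L i))"
    using member_le_sum[of i I "\<lambda>i. onorm (L i)"] \<open>i \<in> I\<close> nonneg assms(1) by simp
  then have "onorm (L i) * norm u \<le> (1 + (\<Sum>i\<in>I. onorm (L i))) * norm u"
    by (rule mult_right_mono) simp
  finally show "norm (L i u) \<le> (1 + (\<Sum>i\<in>I. onorm (L i))) * norm u" .
qed

lemma independent_coordinates:
  fixes T :: "'i \<Rightarrow> 'v::euclidean_space"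
  assumes "finite I" "inj_on T I" "independent (T ` I)"
  obtains L where "\<And>i. i \<in> I \<Longrightarrow> bounded_linear (L i)"
    and "\<And>u. u \<in> span (T ` I) \<Longrightarrow> u = (\<Sum>i\<in>I. L i u *\<^sub>R T i)"
proof -
  have "\<forall>i. \<exists>g. linear g \<and> (\<forall>x\<in>T ` I. g x = (if x = T i then 1 else (0::real)))"
    by (intro allI real_vector.linear_independent_extend[OF assms(3)])
  from choice[OF this] obtain L :: "'i \<Rightarrow> 'v \<Rightarrow> real" where
    L: "\<And>i. linear (L i)" and L_basis: "\<And>i x. x \<in> T ` I \<Longrightarrow> L i x = (if x = T i then 1 else 0)"
    by blast
  have dual: "L i (T j) = (if i = j then 1 else 0)" if "i \<in> I" "j \<in> I" for i j
    using L_basis[of "T j" i] that inj_on_eq_iff[OF assms(2)] by auto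
  show ?thesis
  proof (rule that)
    show "bounded_linear (L i)" if "i \<in> I" for i
      using L[of i] by (simp add: linear_conv_bounded_linear)
    fix u
    assume "u \<in> span (T ` I)"
    then obtain c where "u = (\<Sum>v\<in>T ` I. c v *\<^sub>R v)"
      using real_vector.span_finite[of "T ` I"] assms(1) by auto
    then have u: "u = (\<Sum>j\<in>I. c (T j) *\<^sub>R T j)"
      by (simp add: sum.reindex[OF assms(2)])
    have "L i u = c (T i)" if "i \<in> I" for i
    proof -
      have "L i u = (\<Sum>j\<in>I. c (T j) * L i (T j))"
        by (simp add: u linear_sum[OF L] linear_scale[OF L])
      also have "\<dots> = (\<Sum>j\<in>I. if i = j then c (T j) else 0)"
        by (rule sum.cong) (simp_all add: dual that)
      finally show ?thesis
        using that assms(1) by simp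
    qed
    then show "u = (\<Sum>i\<in>I. L i u *\<^sub>R T i)"
      using u by simp
  qed
qed

lemma transpose_tensor_sq: "transpose (tensor_sq \<xi>) = tensor_sq \<xi>"
  by (simp add: transpose_def tensor_sq_def vec_eq_iff mult.commute)

locale symmetric_frame = holder_domain \<Omega> \<alpha>
  for \<Omega> :: "(real^'n::finite) set" and \<alpha> :: real +
  fixes I :: "'i set" and T :: "'i \<Rightarrow> real^'n^'n" and coord :: "'i \<Rightarrow> real^'n^'n \<Rightarrow> real" and K :: real
  assumes nonempty: "\<Omega> \<noteq> {}" and finite_index: "finite I" and K_nonneg: "K \<ge> 0"
    and symmetric: "\<And>i. i \<in> I \<Longrightarrow> transpose (T i) = T i"
    and coord_linear: "\<And>i. i \<in> I \<Longrightarrow> bounded_linear (coord i)"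
    and coord_bound: "\<And>i u. i \<in> I \<Longrightarrow> \<bar>coord i u\<bar> \<le> K * norm u"
    and coord_repr: "\<And>u. u \<in> span (T ` I) \<Longrightarrow> u = (\<Sum>i\<in>I. coord i u *\<^sub>R T i)"
begin

definition frame_sum :: "real^'n^'n" where
  "frame_sum = (\<Sum>i\<in>I. T i)"

definition radius :: real where
  "radius = supnorm \<Omega> (\<lambda>x. x)"

definition decomposition_const :: real where
  "decomposition_const = 1 + 2 * K * (2 * norm frame_sum + onorm ((*v) frame_sum) * (1 + 3 * radius))"

definition shift :: "(real^'n \<Rightarrow> real^'n^'n) \<Rightarrow> real" where
  "shift D = 2 * K * supnorm \<Omega> D"

definition coeff :: "(real^'n \<Rightarrow> real^'n^'n) \<Rightarrow> 'i \<Rightarrow> real^'n \<Rightarrow> real" where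
  "coeff D i x = sqrt (coord i (D x) + shift D)"

lemma symm_part_frame_sum: "symm_part (c *\<^sub>R frame_sum) = c *\<^sub>R frame_sum"
proof -
  have "T i $ b $ a = T i $ a $ b" if "i \<in> I" for i a b
    using symmetric[OF that] by (metis transpose_def vec_lambda_beta)
  then have "transpose frame_sum = frame_sum"
    by (simp add: frame_sum_def transpose_def vec_eq_iff sum_component)
  then show ?thesis
    by (simp add: symm_part_def transpose_scalar scaleR_2 flip: scaleR_add_left)
qed

lemma norm_le_radius: "x \<in> \<Omega> \<Longrightarrow> norm x \<le> radius"
  unfolding radius_def using supnorm_upper[of "\<lambda>x. x" \<Omega>] bounded_domain by simp

lemma radius_nonneg: "radius \<ge> 0"
  using norm_le_radius nonempty norm_ge_zero order_trans by blast

lemma decomposition_const_ge_1: "decomposition_const \<ge> 1"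
  using K_nonneg radius_nonneg onorm_pos_le[OF matrix_vector_mul_bounded_linear[of frame_sum]]
  by (simp add: decomposition_const_def)

context
  fixes j :: nat and D :: "real^'n \<Rightarrow> real^'n^'n"
  assumes D_holder: "holder_space \<Omega> j \<alpha> D"
    and D_span: "\<And>x. x \<in> closure \<Omega> \<Longrightarrow> D x \<in> span (T ` I)"
begin

lemma D_holder_on: "holder_on \<Omega> \<alpha> j D"
  using D_holder by (simp add: holder_space_iff)

lemma supnorm_D_nonneg: "supnorm \<Omega> D \<ge> 0"
  using nonempty norm_le_supnorm_closure[OF D_holder] closure_subset norm_ge_zero order_trans by blast

lemma coord_shift_lower:
  assumes "i \<in> I" "x \<in> closure \<Omega>"
  shows "\<bar>coord i (D x)\<bar> \<le> K * supnorm \<Omega> D" and "K * supnorm \<Omega> D \<le> coord i (D x) + shift D"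
proof -
  show "\<bar>coord i (D x)\<bar> \<le> K * supnorm \<Omega> D"
    using coord_bound[OF assms(1)] norm_le_supnorm_closure[OF D_holder assms(2)] K_nonneg
    by (meson mult_left_mono order_trans)
  then show "K * supnorm \<Omega> D \<le> coord i (D x) + shift D"
    by (simp add: shift_def)
qed

lemma sum_coeff_squares:
  assumes "x \<in> closure \<Omega>"
  shows "(\<Sum>i\<in>I. (coeff D i x)\<^sup>2 *\<^sub>R T i) = D x + shift D *\<^sub>R frame_sum"
proof -
  have "0 \<le> coord i (D x) + shift D" if "i \<in> I" for i
    using coord_shift_lower(2)[OF that assms] mult_nonneg_nonneg[OF K_nonneg supnorm_D_nonneg] by linarith
  then have "(\<Sum>i\<in>I. (coeff D i x)\<^sup>2 *\<^sub>R T i) = (\<Sum>i\<in>I. coord i (D x) *\<^sub>R T i + shift D *\<^sub>R T i)"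
    by (intro sum.cong) (simp_all add: coeff_def scaleR_add_left)
  also have "\<dots> = D x + shift D *\<^sub>R frame_sum"
    using coord_repr[OF D_span[OF assms]] by (simp add: sum.distrib frame_sum_def scaleR_sum_right)
  finally show ?thesis .
qed

lemma holder_space_coeff:
  assumes "i \<in> I"
  shows "holder_space \<Omega> j \<alpha> (coeff D i)"
proof -
  have "holder_on \<Omega> \<alpha> j (coeff D i)"
  proof (cases "K * supnorm \<Omega> D = 0")
    case True
    have "0 = coeff D i x" if "x \<in> \<Omega>" for x
    proof -
      have "coord i (D x) = 0"
        using coord_shift_lower(1)[OF assms closure_subset[THEN subsetD, OF that]] True by simp
      then show ?thesis
        using True by (simp add: coeff_def shift_def)
    qed
    then show ?thesis
      by (rule holder_on_cong[OF open_domain holder_on_const[OF open_domain]])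
  next
    case False
    then have "K * supnorm \<Omega> D > 0"
      using K_nonneg supnorm_D_nonneg by simp
    moreover have "holder_on \<Omega> \<alpha> j (\<lambda>x. coord i (D x) + shift D)"
      using holder_on_bounded_linear[OF coord_linear[OF assms] D_holder_on] holder_on_const[OF open_domain]
      by (rule holder_on_add)
    ultimately show ?thesis
      unfolding coeff_def[abs_def]
    proof (rule holder_on_sqrt)
      show "K * supnorm \<Omega> D \<le> coord i (D x) + shift D" if "x \<in> \<Omega>" for x
        using coord_shift_lower(2)[OF assms closure_subset[THEN subsetD, OF that]] .
    qed
  qed
  moreover have "continuous_on (closure \<Omega>) (coeff D i)"
    unfolding coeff_def[abs_def] using D_holder
    by (intro continuous_intros bounded_linear.continuous_on[OF coord_linear[OF assms]])
      (simp add: holder_space_iff)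
  ultimately show ?thesis
    by (simp add: holder_space_iff)
qed

lemma shift_terms_le:
  "2 * norm (shift D *\<^sub>R frame_sum) + holder_norm \<Omega> 0 \<alpha> (\<lambda>x. (shift D *\<^sub>R frame_sum) *v x)
     \<le> (decomposition_const - 1) * supnorm \<Omega> D"
proof -
  have shift: "shift D \<ge> 0"
    using K_nonneg supnorm_D_nonneg by (simp add: shift_def)
  have scaled: "(*v) (shift D *\<^sub>R frame_sum) = (\<lambda>x. shift D *\<^sub>R (frame_sum *v x))"
    by (simp add: fun_eq_iff scaleR_matrix_vector_assoc)
  have onorm_eq: "onorm ((*v) (shift D *\<^sub>R frame_sum)) = shift D * onorm ((*v) frame_sum)"
    unfolding scaled onorm_scaleR[OF matrix_vector_mul_bounded_linear] using shift by simp
  have "holder_norm \<Omega> 0 \<alpha> (\<lambda>x. (shift D *\<^sub>R frame_sum) *v x)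
      \<le> onorm ((*v) (shift D *\<^sub>R frame_sum)) * (1 + 3 * radius)"
    by (rule holder_norm_0_matrix_vector_le[OF holder_quots_nonempty[OF open_domain nonempty] norm_le_radius alpha])
  then have "2 * norm (shift D *\<^sub>R frame_sum) + holder_norm \<Omega> 0 \<alpha> (\<lambda>x. (shift D *\<^sub>R frame_sum) *v x)
      \<le> 2 * (shift D * norm frame_sum) + shift D * onorm ((*v) frame_sum) * (1 + 3 * radius)"
    using shift by (simp add: onorm_eq)
  also have "\<dots> = (decomposition_const - 1) * supnorm \<Omega> D"
    by (simp add: decomposition_const_def shift_def algebra_simps)
  finally show ?thesis .
qed

lemma decomposition_estimate_0:
  "holder_norm \<Omega> 0 \<alpha> (\<lambda>x. \<Sum>i\<in>I. (coeff D i x)\<^sup>2 *\<^sub>R T i) + norm (shift D *\<^sub>R frame_sum)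
     + holder_norm \<Omega> 0 \<alpha> (\<lambda>x. (shift D *\<^sub>R frame_sum) *v x) \<le> decomposition_const * holder_norm \<Omega> 0 \<alpha> D"
proof -
  have "holder_norm \<Omega> 0 \<alpha> (\<lambda>x. \<Sum>i\<in>I. (coeff D i x)\<^sup>2 *\<^sub>R T i) = holder_norm \<Omega> 0 \<alpha> (\<lambda>x. D x + shift D *\<^sub>R frame_sum)"
    using sum_coeff_squares closure_subset by (intro holder_norm_cong[OF open_domain]) auto
  also have "\<dots> \<le> holder_norm \<Omega> 0 \<alpha> D + norm (shift D *\<^sub>R frame_sum)"
    using bounded_pdiff_image[OF D_holder_on, of "[]"] nonempty by (intro holder_norm_0_add_const_le) auto
  finally have "holder_norm \<Omega> 0 \<alpha> (\<lambda>x. \<Sum>i\<in>I. (coeff D i x)\<^sup>2 *\<^sub>R T i) + norm (shift D *\<^sub>R frame_sum)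
      + holder_norm \<Omega> 0 \<alpha> (\<lambda>x. (shift D *\<^sub>R frame_sum) *v x)
      \<le> holder_norm \<Omega> 0 \<alpha> D + (decomposition_const - 1) * supnorm \<Omega> D"
    using shift_terms_le by linarith
  also have "\<dots> \<le> holder_norm \<Omega> 0 \<alpha> D + (decomposition_const - 1) * holder_norm \<Omega> 0 \<alpha> D"
  proof -
    have "supnorm \<Omega> D \<le> holder_norm \<Omega> 0 \<alpha> D"
      using supnorm_add_holder_seminorm_le[OF holder_on_mono[OF _ D_holder_on] nonempty]
        holder_seminorm_nonneg[OF holder_on_mono[OF _ D_holder_on] nonempty] by fastforce
    then show ?thesis
      using decomposition_const_ge_1 by (simp add: mult_left_mono)
  qed
  also have "\<dots> = decomposition_const * holder_norm \<Omega> 0 \<alpha> D"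
    by (simp add: algebra_simps)
  finally show ?thesis .
qed

lemma decomposition_estimate:
  "holder_seminorm \<Omega> j \<alpha> (\<lambda>x. \<Sum>i\<in>I. (coeff D i x)\<^sup>2 *\<^sub>R T i) + norm (shift D *\<^sub>R frame_sum)
     + holder_norm \<Omega> 0 \<alpha> (\<lambda>x. (shift D *\<^sub>R frame_sum) *v x) \<le> decomposition_const * holder_norm \<Omega> j \<alpha> D"
proof -
  have "holder_seminorm \<Omega> j \<alpha> (\<lambda>x. \<Sum>i\<in>I. (coeff D i x)\<^sup>2 *\<^sub>R T i)
      = holder_seminorm \<Omega> j \<alpha> (\<lambda>x. D x + shift D *\<^sub>R frame_sum)"
    using sum_coeff_squares closure_subset by (intro holder_seminorm_cong[OF open_domain]) auto
  also have "\<dots> = holder_seminorm \<Omega> j \<alpha> D"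
    using D_holder_on by (intro holder_seminorm_add_const[OF open_domain]) (simp add: holder_on_def)
  finally have "holder_seminorm \<Omega> j \<alpha> (\<lambda>x. \<Sum>i\<in>I. (coeff D i x)\<^sup>2 *\<^sub>R T i) + norm (shift D *\<^sub>R frame_sum)
      + holder_norm \<Omega> 0 \<alpha> (\<lambda>x. (shift D *\<^sub>R frame_sum) *v x)
      \<le> holder_seminorm \<Omega> j \<alpha> D + (decomposition_const - 1) * supnorm \<Omega> D"
    using shift_terms_le norm_ge_zero[of "shift D *\<^sub>R frame_sum"] by linarith
  also have "\<dots> \<le> decomposition_const * (supnorm \<Omega> D + holder_seminorm \<Omega> j \<alpha> D)"
  proof -
    have "holder_seminorm \<Omega> j \<alpha> D \<le> decomposition_const * holder_seminorm \<Omega> j \<alpha> D"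
      using mult_right_mono[OF decomposition_const_ge_1 holder_seminorm_nonneg[OF D_holder_on nonempty]] by simp
    then show ?thesis
      unfolding left_diff_distrib distrib_left using supnorm_D_nonneg by linarith
  qed
  also have "\<dots> \<le> decomposition_const * holder_norm \<Omega> j \<alpha> D"
    using supnorm_add_holder_seminorm_le[OF D_holder_on nonempty] decomposition_const_ge_1 by simp
  finally show ?thesis .
qed

lemma square_decomposition:
  "\<exists>Phi a G. Cinf_closure \<Omega> Phi \<and> (\<forall>i\<in>I. holder_space \<Omega> j \<alpha> (a i)) \<and>
     (\<forall>x\<in>\<Omega>. (Phi has_derivative (\<lambda>h. G *v h)) (at x)) \<and>
     (\<forall>x\<in>closure \<Omega>. D x + symm_part G = (\<Sum>i\<in>I. (a i x)\<^sup>2 *\<^sub>R T i)) \<and>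
     holder_norm \<Omega> 0 \<alpha> (\<lambda>x. \<Sum>i\<in>I. (a i x)\<^sup>2 *\<^sub>R T i) + norm G + holder_norm \<Omega> 0 \<alpha> Phi
       \<le> decomposition_const * holder_norm \<Omega> 0 \<alpha> D \<and>
     holder_seminorm \<Omega> j \<alpha> (\<lambda>x. \<Sum>i\<in>I. (a i x)\<^sup>2 *\<^sub>R T i) + norm G + holder_norm \<Omega> 0 \<alpha> Phi
       \<le> decomposition_const * holder_norm \<Omega> j \<alpha> D"
proof (intro exI[of _ "\<lambda>x. (shift D *\<^sub>R frame_sum) *v x"] exI[of _ "coeff D"]
    exI[of _ "shift D *\<^sub>R frame_sum"] conjI ballI)
  show "Cinf_closure \<Omega> (\<lambda>x. (shift D *\<^sub>R frame_sum) *v x)"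
    by (rule Cinf_closure_matrix_vector)
  show "holder_space \<Omega> j \<alpha> (coeff D i)" if "i \<in> I" for i
    using that by (rule holder_space_coeff)
  show "((\<lambda>x. (shift D *\<^sub>R frame_sum) *v x) has_derivative (\<lambda>h. (shift D *\<^sub>R frame_sum) *v h)) (at x)"
    if "x \<in> \<Omega>" for x
    by (rule bounded_linear_imp_has_derivative[OF matrix_vector_mul_bounded_linear])
  show "D x + symm_part (shift D *\<^sub>R frame_sum) = (\<Sum>i\<in>I. (coeff D i x)\<^sup>2 *\<^sub>R T i)"
    if "x \<in> closure \<Omega>" for x
    using that by (simp add: sum_coeff_squares symm_part_frame_sum)
qed (rule decomposition_estimate_0 decomposition_estimate)+

end

end

theorem lemma3p3:
  fixes \<Omega> :: "(real^'n) set" and j :: nat and \<alpha> :: real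
    and U :: "(real^'n^'n) set" and nU :: nat and \<xi> :: "nat \<Rightarrow> real^'n" and Mhat :: real
  assumes "open \<Omega>" and "connected \<Omega>" and "\<Omega> \<noteq> {}" and "bounded \<Omega>" and "C2_boundary \<Omega>"
    and "0 < \<alpha>" and "\<alpha> < 1"
    and "inj_on (\<lambda>i. tensor_sq (\<xi> i)) {1..nU}"
    and "independent ((\<lambda>i. tensor_sq (\<xi> i)) ` {1..nU})"
    and "U = span ((\<lambda>i. tensor_sq (\<xi> i)) ` {1..nU})"
    and "\<forall>i\<in>{1..nU}. norm (tensor_sq (\<xi> i)) = 1"
    and "Mhat > 0"
  shows "\<exists>M1>0. \<exists>M2>0. \<forall>Dh :: real^'n \<Rightarrow> real^'n^'n.
           holder_space \<Omega> j \<alpha> Dh \<and> (\<forall>x\<in>closure \<Omega>. Dh x \<in> U) \<and> holder_norm \<Omega> 0 \<alpha> Dh \<le> Mhat \<longrightarrow>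
           (\<exists>Phi :: real^'n \<Rightarrow> real^'n. \<exists>a :: nat \<Rightarrow> real^'n \<Rightarrow> real. \<exists>G :: real^'n^'n.
              Cinf_closure \<Omega> Phi \<and> (\<forall>i\<in>{1..nU}. holder_space \<Omega> j \<alpha> (a i)) \<and>
              (\<forall>x\<in>\<Omega>. (Phi has_derivative (\<lambda>h. G *v h)) (at x)) \<and>
              (\<forall>x\<in>closure \<Omega>. Dh x + symm_part G = (\<Sum>i=1..nU. (a i x)\<^sup>2 *\<^sub>R tensor_sq (\<xi> i))) \<and>
              holder_norm \<Omega> 0 \<alpha> (\<lambda>x. \<Sum>i=1..nU. (a i x)\<^sup>2 *\<^sub>R tensor_sq (\<xi> i)) + norm G
                + holder_norm \<Omega> 0 \<alpha> Phi \<le> M1 * holder_norm \<Omega> 0 \<alpha> Dh \<and>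
              holder_seminorm \<Omega> j \<alpha> (\<lambda>x. \<Sum>i=1..nU. (a i x)\<^sup>2 *\<^sub>R tensor_sq (\<xi> i)) + norm G
                + holder_norm \<Omega> 0 \<alpha> Phi \<le> M2 * holder_norm \<Omega> j \<alpha> Dh)"
proof -
  have domain: "holder_domain \<Omega> \<alpha>"
    using assms by unfold_locales auto
  obtain coord where coord_linear: "\<And>i. i \<in> {1..nU} \<Longrightarrow> bounded_linear (coord i)"
    and coord_repr: "\<And>u. u \<in> U \<Longrightarrow> u = (\<Sum>i=1..nU. coord i u *\<^sub>R tensor_sq (\<xi> i))"
    using independent_coordinates[of "{1..nU}" "\<lambda>i. tensor_sq (\<xi> i)"] assms(8-10) by auto
  obtain K where K: "K > 0" "\<And>i u. i \<in> {1..nU} \<Longrightarrow> norm (coord i u) \<le> K * norm u"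
    using bounded_linear_family_bound[of "{1..nU}" coord] coord_linear by blast
  have "symmetric_frame \<Omega> \<alpha> {1..nU} (\<lambda>i. tensor_sq (\<xi> i)) coord K"
    unfolding symmetric_frame_def symmetric_frame_axioms_def
    using domain assms(3,10) K coord_linear coord_repr by (auto simp: transpose_tensor_sq)
  then interpret symmetric_frame \<Omega> \<alpha> "{1..nU}" "\<lambda>i. tensor_sq (\<xi> i)" coord K .
  have positive: "decomposition_const > 0"
    using decomposition_const_ge_1 by simp
  show ?thesis
    by (intro exI[of _ decomposition_const] conjI allI impI positive; elim conjE; rule square_decomposition)
      (use assms(10) in auto)
qed

end
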